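(* Let $\mathcal{C}$ be an exact Mal'tsev category. The following conditions are equivalent: (i) $\mathcal{C}$ is arithmetical; (ii) $\mathcal{C}$ satisfies $(\mathrm{CRT}_3)$; (iii) $\mathcal{C}$ satisfies $(\mathrm{CRT}_n)$ for every $n\ge 2$.
   Context: All categories are assumed finitely complete. A category is regular if kernel pairs admit coequalizers and regular epimorphisms are stable under pullback. It is (Barr-)exact if it is regular and every internal equivalence relation is effective, i.e. is the kernel pair of some morphism. A Mal'tsev category is a finitely complete category in which every internal reflexive relation $R\rightarrowtail X\times X$ is an equivalence relation. For an object $X$, $\mathrm{Equiv}(X)$ denotes the poset of internal equivalence relations on $X$, ordered by inclusion of subobjects of $X\times X$; in an exact Mal'tsev category it is a lattice (meets are intersections, and the join of $\theta$ and $\varphi$ is the relational composite $\theta\circ\varphi=\varphi\circ\theta$). An exact Mal'tsev category is arithmetical if the lattice $\mathrm{Equiv}(X)$ is distributive for every object $X$. For $\theta\in\mathrm{Equiv}(X)$ in an exact category, $q_\theta\colon X\to X/\theta$ denotes the quotient, a regular epimorphism with kernel pair $\theta$. Given $n\ge 2$ and $\theta_1,\dots,\theta_n\in\mathrm{Equiv}(X)$, write $q_i=q_{\theta_i}$ and, for $i\ne j$, $q_{ij}\colon X/\theta_i\to X/(\theta_i\vee\theta_j)$ for the canonical quotient. Let $L(\theta_1,\dots,\theta_n)$ be the limit of the diagram formed by the objects $X/\theta_i$ ($1\le i\le n$) and $X/(\theta_i\vee\theta_j)$ ($1\le i<j\le n$) together with all the morphisms $q_{ij}$. The cone $(q_i)_i$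 induces a canonical morphism $c\colon X\to L(\theta_1,\dots,\theta_n)$. The family $(\theta_1,\dots,\theta_n)$ satisfies the CRT if $c$ is a regular epimorphism. The category $\mathcal{C}$ satisfies $(\mathrm{CRT}_n)$ if every family of $n$ equivalence relations on every object of $\mathcal{C}$ satisfies the CRT. *)

theory Defs
  imports "HOL-Algebra.Lattice"
begin

section \<open>Categories and finite limits\<close>

record ('o, 'm) cat =
  Ob :: "'o set"
  Ar :: "'m set"
  Dom :: "'m \<Rightarrow> 'o"
  Cod :: "'m \<Rightarrow> 'o"
  Idn :: "'o \<Rightarrow> 'm"
  Cmp :: "'m \<Rightarrow> 'm \<Rightarrow> 'm"  (infixl "\<cdot>\<index>" 70)

text \<open>Composition is written in the usual order: \<open>g \<cdot> f\<close> is first \<open>f\<close>, then \<open>g\<close>.\<close>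

definition Hom :: "('o, 'm, 'z) cat_scheme \<Rightarrow> 'o \<Rightarrow> 'o \<Rightarrow> 'm set" where
  "Hom C X Y = {f \<in> Ar C. Dom C f = X \<and> Cod C f = Y}"

locale category =
  fixes C :: "('o, 'm, 'z) cat_scheme" (structure)
  assumes Dom_in_Ob: "f \<in> Ar C \<Longrightarrow> Dom C f \<in> Ob C"
    and Cod_in_Ob: "f \<in> Ar C \<Longrightarrow> Cod C f \<in> Ob C"
    and Idn_in_Hom: "X \<in> Ob C \<Longrightarrow> Idn C X \<in> Hom C X X"
    and Cmp_in_Hom: "\<lbrakk>f \<in> Hom C X Y; g \<in> Hom C Y Z\<rbrakk> \<Longrightarrow> g \<cdot> f \<in> Hom C X Z"
    and Idn_left: "f \<in> Hom C X Y \<Longrightarrow> Idn C Y \<cdot> f = f"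
    and Idn_right: "f \<in> Hom C X Y \<Longrightarrow> f \<cdot> Idn C X = f"
    and Cmp_assoc: "\<lbrakk>f \<in> Hom C W X; g \<in> Hom C X Y; h \<in> Hom C Y Z\<rbrakk>
                      \<Longrightarrow> (h \<cdot> g) \<cdot> f = h \<cdot> (g \<cdot> f)"

text \<open>A diagram is indexed by a directed graph: \<open>V\<close> is the set of vertices, \<open>D\<close> assigns an
  object to each vertex, and \<open>E\<close> consists of triples \<open>(u, v, f)\<close>, an edge from \<open>u\<close> to \<open>v\<close>
  sent to the morphism \<open>f\<close>. (Parallel edges sent to the same morphism are identified; this
  does not affect cones.)\<close>

definition is_diagram ::
  "('o, 'm, 'z) cat_scheme \<Rightarrow> 'v set \<Rightarrow> ('v \<Rightarrow> 'o) \<Rightarrow> ('v \<times> 'v \<times> 'm) set \<Rightarrow> bool" where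
  "is_diagram C V D E \<longleftrightarrow>
     (\<forall>v\<in>V. D v \<in> Ob C) \<and>
     (\<forall>(u, v, f)\<in>E. u \<in> V \<and> v \<in> V \<and> f \<in> Hom C (D u) (D v))"

definition is_cone ::
  "('o, 'm, 'z) cat_scheme \<Rightarrow> 'v set \<Rightarrow> ('v \<Rightarrow> 'o) \<Rightarrow> ('v \<times> 'v \<times> 'm) set
     \<Rightarrow> 'o \<Rightarrow> ('v \<Rightarrow> 'm) \<Rightarrow> bool" where
  "is_cone C V D E A a \<longleftrightarrow>
     A \<in> Ob C \<and>
     (\<forall>v\<in>V. a v \<in> Hom C A (D v)) \<and>
     (\<forall>(u, v, f)\<in>E. f \<cdot>\<^bsub>C\<^esub> a u = a v)"

definition is_limit ::
  "('o, 'm, 'z) cat_scheme \<Rightarrow> 'v set \<Rightarrow> ('v \<Rightarrow> 'o) \<Rightarrow> ('v \<times> 'v \<times> 'm) set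
     \<Rightarrow> 'o \<Rightarrow> ('v \<Rightarrow> 'm) \<Rightarrow> bool" where
  "is_limit C V D E L p \<longleftrightarrow>
     is_cone C V D E L p \<and>
     (\<forall>A a. is_cone C V D E A a \<longrightarrow>
        (\<exists>!h. h \<in> Hom C A L \<and> (\<forall>v\<in>V. p v \<cdot>\<^bsub>C\<^esub> h = a v)))"

text \<open>Every finite graph is isomorphic to one whose vertices are natural numbers, so nothing is
  lost by fixing the type of vertices.\<close>

locale finitely_complete_category = category +
  assumes finite_limits:
    "\<And>(V :: nat set) D E. \<lbrakk>finite V; finite E; is_diagram C V D E\<rbrakk>
       \<Longrightarrow> \<exists>L p. is_limit C V D E L p"

definition is_product :: "('o, 'm, 'z) cat_scheme \<Rightarrow> 'o \<Rightarrow> 'o \<Rightarrow> 'm \<Rightarrow> 'm \<Rightarrow> bool" where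
  "is_product C X Y p1 p2 \<longleftrightarrow>
     (\<exists>P. p1 \<in> Hom C P X \<and> p2 \<in> Hom C P Y \<and>
        (\<forall>A. \<forall>f\<in>Hom C A X. \<forall>g\<in>Hom C A Y.
           \<exists>!h. h \<in> Hom C A P \<and> p1 \<cdot>\<^bsub>C\<^esub> h = f \<and> p2 \<cdot>\<^bsub>C\<^esub> h = g))"

text \<open>\<open>is_pullback C f g p1 p2\<close>: the square \<open>f \<cdot> p1 = g \<cdot> p2\<close> is a pullback;
  \<open>p2\<close> is the pullback of \<open>f\<close> along \<open>g\<close>.\<close>

definition is_pullback :: "('o, 'm, 'z) cat_scheme \<Rightarrow> 'm \<Rightarrow> 'm \<Rightarrow> 'm \<Rightarrow> 'm \<Rightarrow> bool" where
  "is_pullback C f g p1 p2 \<longleftrightarrow>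
     (\<exists>X Y Z P. f \<in> Hom C X Z \<and> g \<in> Hom C Y Z \<and> p1 \<in> Hom C P X \<and> p2 \<in> Hom C P Y \<and>
        f \<cdot>\<^bsub>C\<^esub> p1 = g \<cdot>\<^bsub>C\<^esub> p2 \<and>
        (\<forall>A. \<forall>a\<in>Hom C A X. \<forall>b\<in>Hom C A Y. f \<cdot>\<^bsub>C\<^esub> a = g \<cdot>\<^bsub>C\<^esub> b \<longrightarrow>
           (\<exists>!h. h \<in> Hom C A P \<and> p1 \<cdot>\<^bsub>C\<^esub> h = a \<and> p2 \<cdot>\<^bsub>C\<^esub> h = b)))"

definition is_kernel_pair :: "('o, 'm, 'z) cat_scheme \<Rightarrow> 'm \<Rightarrow> 'm \<Rightarrow> 'm \<Rightarrow> bool" where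
  "is_kernel_pair C f k1 k2 \<longleftrightarrow> is_pullback C f f k1 k2"

definition is_coequalizer :: "('o, 'm, 'z) cat_scheme \<Rightarrow> 'm \<Rightarrow> 'm \<Rightarrow> 'm \<Rightarrow> bool" where
  "is_coequalizer C u v q \<longleftrightarrow>
     (\<exists>W X Q. u \<in> Hom C W X \<and> v \<in> Hom C W X \<and> q \<in> Hom C X Q \<and>
        q \<cdot>\<^bsub>C\<^esub> u = q \<cdot>\<^bsub>C\<^esub> v \<and>
        (\<forall>B. \<forall>f\<in>Hom C X B. f \<cdot>\<^bsub>C\<^esub> u = f \<cdot>\<^bsub>C\<^esub> v \<longrightarrow>
           (\<exists>!h. h \<in> Hom C Q B \<and> h \<cdot>\<^bsub>C\<^esub> q = f)))"

definition mono_arrow :: "('o, 'm, 'z) cat_scheme \<Rightarrow> 'm \<Rightarrow> bool" where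
  "mono_arrow C m \<longleftrightarrow>
     m \<in> Ar C \<and>
     (\<forall>A. \<forall>f\<in>Hom C A (Dom C m). \<forall>g\<in>Hom C A (Dom C m).
        m \<cdot>\<^bsub>C\<^esub> f = m \<cdot>\<^bsub>C\<^esub> g \<longrightarrow> f = g)"

definition regular_epi :: "('o, 'm, 'z) cat_scheme \<Rightarrow> 'm \<Rightarrow> bool" where
  "regular_epi C q \<longleftrightarrow> (\<exists>u v. is_coequalizer C u v q)"


section \<open>Internal equivalence relations\<close>

text \<open>The projections of a chosen product \<open>X \<times> X\<close>, whose vertex is their common domain.\<close>

definition sq_proj :: "('o, 'm, 'z) cat_scheme \<Rightarrow> 'o \<Rightarrow> 'm \<times> 'm" where
  "sq_proj C X = (SOME p. is_product C X X (fst p) (snd p))"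

definition pr1 :: "('o, 'm, 'z) cat_scheme \<Rightarrow> 'o \<Rightarrow> 'm" where
  "pr1 C X = fst (sq_proj C X)"

definition pr2 :: "('o, 'm, 'z) cat_scheme \<Rightarrow> 'o \<Rightarrow> 'm" where
  "pr2 C X = snd (sq_proj C X)"

definition sq_obj :: "('o, 'm, 'z) cat_scheme \<Rightarrow> 'o \<Rightarrow> 'o" where
  "sq_obj C X = Dom C (pr1 C X)"

definition is_relation :: "('o, 'm, 'z) cat_scheme \<Rightarrow> 'o \<Rightarrow> 'm \<Rightarrow> bool" where
  "is_relation C X r \<longleftrightarrow> X \<in> Ob C \<and> mono_arrow C r \<and> Cod C r = sq_obj C X"

text \<open>The two legs \<open>R \<rightarrow> X\<close> of a relation \<open>R \<rightarrow> X \<times> X\<close>.\<close>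

definition leg1 :: "('o, 'm, 'z) cat_scheme \<Rightarrow> 'o \<Rightarrow> 'm \<Rightarrow> 'm" where
  "leg1 C X r = pr1 C X \<cdot>\<^bsub>C\<^esub> r"

definition leg2 :: "('o, 'm, 'z) cat_scheme \<Rightarrow> 'o \<Rightarrow> 'm \<Rightarrow> 'm" where
  "leg2 C X r = pr2 C X \<cdot>\<^bsub>C\<^esub> r"

definition reflexive_rel :: "('o, 'm, 'z) cat_scheme \<Rightarrow> 'o \<Rightarrow> 'm \<Rightarrow> bool" where
  "reflexive_rel C X r \<longleftrightarrow>
     (\<exists>s\<in>Hom C X (Dom C r). leg1 C X r \<cdot>\<^bsub>C\<^esub> s = Idn C X \<and> leg2 C X r \<cdot>\<^bsub>C\<^esub> s = Idn C X)"

definition symmetric_rel :: "('o, 'm, 'z) cat_scheme \<Rightarrow> 'o \<Rightarrow> 'm \<Rightarrow> bool" where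
  "symmetric_rel C X r \<longleftrightarrow>
     (\<exists>t\<in>Hom C (Dom C r) (Dom C r).
        leg1 C X r \<cdot>\<^bsub>C\<^esub> t = leg2 C X r \<and> leg2 C X r \<cdot>\<^bsub>C\<^esub> t = leg1 C X r)"

text \<open>The domain of \<open>p1\<close> and \<open>p2\<close> below is the object of composable pairs \<open>R \<times>\<^sub>X R\<close>.\<close>

definition transitive_rel :: "('o, 'm, 'z) cat_scheme \<Rightarrow> 'o \<Rightarrow> 'm \<Rightarrow> bool" where
  "transitive_rel C X r \<longleftrightarrow>
     (\<forall>p1 p2. is_pullback C (leg2 C X r) (leg1 C X r) p1 p2 \<longrightarrow>
        (\<exists>t\<in>Hom C (Dom C p1) (Dom C r).
           leg1 C X r \<cdot>\<^bsub>C\<^esub> t = leg1 C X r \<cdot>\<^bsub>C\<^esub> p1 \<and>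
           leg2 C X r \<cdot>\<^bsub>C\<^esub> t = leg2 C X r \<cdot>\<^bsub>C\<^esub> p2))"

definition equivalence_rel :: "('o, 'm, 'z) cat_scheme \<Rightarrow> 'o \<Rightarrow> 'm \<Rightarrow> bool" where
  "equivalence_rel C X r \<longleftrightarrow>
     is_relation C X r \<and> reflexive_rel C X r \<and> symmetric_rel C X r \<and> transitive_rel C X r"

text \<open>Subobjects are represented by monomorphisms, so \<open>Equiv C X\<close> is an ordered set in the
  setoid sense of HOL-Algebra: its equality identifies monomorphisms that represent the same
  subobject of \<open>X \<times> X\<close>.\<close>

definition sub_le :: "('o, 'm, 'z) cat_scheme \<Rightarrow> 'm \<Rightarrow> 'm \<Rightarrow> bool" where
  "sub_le C r s \<longleftrightarrow> (\<exists>m\<in>Hom C (Dom C r) (Dom C s). s \<cdot>\<^bsub>C\<^esub> m = r)"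

definition Equiv :: "('o, 'm, 'z) cat_scheme \<Rightarrow> 'o \<Rightarrow> 'm gorder" where
  "Equiv C X = \<lparr> carrier = {r. equivalence_rel C X r},
                 eq = (\<lambda>r s. sub_le C r s \<and> sub_le C s r),
                 le = sub_le C \<rparr>"


section \<open>Regular, exact, Mal'tsev and arithmetical categories\<close>

locale regular_category = finitely_complete_category +
  assumes kernel_pair_coequalizer:
    "is_kernel_pair C f k1 k2 \<Longrightarrow> \<exists>q. is_coequalizer C k1 k2 q"
    and regular_epi_stable:
    "\<lbrakk>regular_epi C f; is_pullback C f g p1 p2\<rbrakk> \<Longrightarrow> regular_epi C p2"

locale exact_category = regular_category +
  assumes effective:
    "equivalence_rel C X r \<Longrightarrow> \<exists>f. is_kernel_pair C f (leg1 C X r) (leg2 C X r)"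

locale maltsev_category = finitely_complete_category +
  assumes reflexive_imp_equivalence:
    "\<lbrakk>is_relation C X r; reflexive_rel C X r\<rbrakk> \<Longrightarrow> equivalence_rel C X r"

locale exact_maltsev_category = exact_category + maltsev_category

definition distributive_weak_lattice :: "('a, 'b) gorder_scheme \<Rightarrow> bool" where
  "distributive_weak_lattice L \<longleftrightarrow>
     weak_lattice L \<and>
     (\<forall>x\<in>carrier L. \<forall>y\<in>carrier L. \<forall>z\<in>carrier L.
        x \<sqinter>\<^bsub>L\<^esub> (y \<squnion>\<^bsub>L\<^esub> z) .=\<^bsub>L\<^esub> (x \<sqinter>\<^bsub>L\<^esub> y) \<squnion>\<^bsub>L\<^esub> (x \<sqinter>\<^bsub>L\<^esub> z))"

definition arithmetical :: "('o, 'm, 'z) cat_scheme \<Rightarrow> bool" where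
  "arithmetical C \<longleftrightarrow>
     exact_maltsev_category C \<and> (\<forall>X\<in>Ob C. distributive_weak_lattice (Equiv C X))"


section \<open>The Chinese Remainder condition\<close>

text \<open>\<open>quot C X \<theta>\<close> is a chosen quotient morphism \<open>q\<^sub>\<theta> : X \<rightarrow> X/\<theta>\<close>. For \<open>\<theta> \<le> \<phi>\<close>,
  \<open>quot_map C X \<theta> \<phi>\<close> is the canonical morphism \<open>X/\<theta> \<rightarrow> X/\<phi>\<close>.\<close>

definition quot :: "('o, 'm, 'z) cat_scheme \<Rightarrow> 'o \<Rightarrow> 'm \<Rightarrow> 'm" where
  "quot C X \<theta> = (SOME q. regular_epi C q \<and> is_kernel_pair C q (leg1 C X \<theta>) (leg2 C X \<theta>))"

definition quot_map :: "('o, 'm, 'z) cat_scheme \<Rightarrow> 'o \<Rightarrow> 'm \<Rightarrow> 'm \<Rightarrow> 'm" where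
  "quot_map C X \<theta> \<phi> =
     (THE h. h \<in> Hom C (Cod C (quot C X \<theta>)) (Cod C (quot C X \<phi>)) \<and>
             h \<cdot>\<^bsub>C\<^esub> quot C X \<theta> = quot C X \<phi>)"

text \<open>The vertex \<open>(i, i)\<close> carries \<open>X/\<theta>\<^sub>i\<close> and, for \<open>i < j\<close>, the vertex \<open>(i, j)\<close> carries
  \<open>X/(\<theta>\<^sub>i \<squnion> \<theta>\<^sub>j)\<close>. The two edges into \<open>(i, j)\<close> are \<open>q\<^sub>i\<^sub>j\<close> from \<open>(i, i)\<close> and \<open>q\<^sub>j\<^sub>i\<close> from \<open>(j, j)\<close>.\<close>

definition crt_rel ::
  "('o, 'm, 'z) cat_scheme \<Rightarrow> 'o \<Rightarrow> (nat \<Rightarrow> 'm) \<Rightarrow> nat \<times> nat \<Rightarrow> 'm" where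
  "crt_rel C X \<theta> = (\<lambda>(i, j). if i = j then \<theta> i else \<theta> i \<squnion>\<^bsub>Equiv C X\<^esub> \<theta> j)"

definition crt_vertices :: "nat \<Rightarrow> (nat \<times> nat) set" where
  "crt_vertices n = {(i, j). 1 \<le> i \<and> i \<le> j \<and> j \<le> n}"

definition crt_ob ::
  "('o, 'm, 'z) cat_scheme \<Rightarrow> 'o \<Rightarrow> (nat \<Rightarrow> 'm) \<Rightarrow> nat \<times> nat \<Rightarrow> 'o" where
  "crt_ob C X \<theta> v = Cod C (quot C X (crt_rel C X \<theta> v))"

definition crt_edges ::
  "('o, 'm, 'z) cat_scheme \<Rightarrow> 'o \<Rightarrow> nat \<Rightarrow> (nat \<Rightarrow> 'm)
     \<Rightarrow> ((nat \<times> nat) \<times> (nat \<times> nat) \<times> 'm) set" where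
  "crt_edges C X n \<theta> =
     {((i, i), (i, j), quot_map C X (\<theta> i) (\<theta> i \<squnion>\<^bsub>Equiv C X\<^esub> \<theta> j)) | i j.
        1 \<le> i \<and> i < j \<and> j \<le> n} \<union>
     {((j, j), (i, j), quot_map C X (\<theta> j) (\<theta> i \<squnion>\<^bsub>Equiv C X\<^esub> \<theta> j)) | i j.
        1 \<le> i \<and> i < j \<and> j \<le> n}"

text \<open>The limit is only determined up to isomorphism; the condition is required for every
  choice of limit cone \<open>(L, p)\<close>, with \<open>c\<close> the morphism induced by the cone of quotients.\<close>

definition satisfies_CRT ::
  "('o, 'm, 'z) cat_scheme \<Rightarrow> 'o \<Rightarrow> nat \<Rightarrow> (nat \<Rightarrow> 'm) \<Rightarrow> bool" where
  "satisfies_CRT C X n \<theta> \<longleftrightarrow>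
     (\<forall>L p c.
        is_limit C (crt_vertices n) (crt_ob C X \<theta>) (crt_edges C X n \<theta>) L p \<and>
        c \<in> Hom C X L \<and>
        (\<forall>v\<in>crt_vertices n. p v \<cdot>\<^bsub>C\<^esub> c = quot C X (crt_rel C X \<theta> v)) \<longrightarrow>
        regular_epi C c)"

definition CRT :: "('o, 'm, 'z) cat_scheme \<Rightarrow> nat \<Rightarrow> bool" where
  "CRT C n \<longleftrightarrow>
     (\<forall>X\<in>Ob C. \<forall>\<theta>. (\<forall>i\<in>{1..n}. \<theta> i \<in> carrier (Equiv C X)) \<longrightarrow> satisfies_CRT C X n \<theta>)"

end

theory Submission
  imports Defs
begin

text \<open>Everything is computed on generalized elements \<open>x, y : A \<rightarrow> X\<close>, where existence is meant
  locally, i.e. after pulling back along a regular epimorphism \<open>B \<rightarrow> A\<close>. By the Mal'tsev property the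
  join of two equivalence relations is their composite, so \<open>(x, y) \<in> \<theta> \<squnion> \<phi>\<close> means that locally
  \<open>x \<theta> z \<phi> y\<close> for some \<open>z\<close>; and the comparison \<open>c : X \<rightarrow> L\<close> is a regular epimorphism iff every
  family \<open>x\<^sub>i\<close> with \<open>(x\<^sub>i, x\<^sub>j) \<in> \<theta>\<^sub>i \<squnion> \<theta>\<^sub>j\<close> locally has a common solution \<open>x \<theta>\<^sub>i x\<^sub>i\<close>.
  The classical arguments then apply. If \<open>(x, y) \<in> \<theta> \<sqinter> (\<phi> \<squnion> \<psi>)\<close>, a solution \<open>z\<close> for the family
  \<open>x, x, y\<close> and the relations \<open>\<theta>, \<phi>, \<psi>\<close> gives \<open>x (\<theta> \<sqinter> \<phi>) z (\<theta> \<sqinter> \<psi>) y\<close>. Conversely a solution \<open>y\<close>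
  for the first \<open>k\<close> relations is related to \<open>x\<^sub>k\<^sub>+\<^sub>1\<close> by the meet of all \<open>\<theta>\<^sub>i \<squnion> \<theta>\<^sub>k\<^sub>+\<^sub>1\<close>, which is
  \<open>(\<theta>\<^sub>1 \<sqinter> \<dots> \<sqinter> \<theta>\<^sub>k) \<squnion> \<theta>\<^sub>k\<^sub>+\<^sub>1\<close> by distributivity.\<close>

section \<open>Regular epimorphisms and finite limits\<close>

context category
begin

lemma Hom_Ob: "f \<in> Hom C X Y \<Longrightarrow> X \<in> Ob C \<and> Y \<in> Ob C"
  using Dom_in_Ob Cod_in_Ob by (auto simp: Hom_def)

lemma Hom_Dom: "f \<in> Hom C X Y \<Longrightarrow> Dom C f = X"
  by (simp add: Hom_def)

lemma mono_arrowD: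
  assumes "mono_arrow C m" "m \<in> Hom C I Y" "f \<in> Hom C A I" "g \<in> Hom C A I" "m \<cdot> f = m \<cdot> g"
  shows "f = g"
  using assms by (auto simp: mono_arrow_def Hom_def)

lemma mono_arrowI:
  assumes "m \<in> Hom C I Y"
    and "\<And>A f g. \<lbrakk>f \<in> Hom C A I; g \<in> Hom C A I; m \<cdot> f = m \<cdot> g\<rbrakk> \<Longrightarrow> f = g"
  shows "mono_arrow C m"
  using assms by (auto simp: mono_arrow_def Hom_def)

lemma regular_epi_coequalizer:
  assumes "regular_epi C q" "q \<in> Hom C X Q"
  obtains u W v where "u \<in> Hom C W X" "v \<in> Hom C W X" "q \<cdot> u = q \<cdot> v"
    "\<forall>B. \<forall>f\<in>Hom C X B. f \<cdot> u = f \<cdot> v \<longrightarrow> (\<exists>!h. h \<in> Hom C Q B \<and> h \<cdot> q = f)"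
proof -
  obtain u v W X' Q' where c: "u \<in> Hom C W X'" "v \<in> Hom C W X'" "q \<in> Hom C X' Q'"
    "q \<cdot> u = q \<cdot> v"
    "\<forall>B. \<forall>f\<in>Hom C X' B. f \<cdot> u = f \<cdot> v \<longrightarrow> (\<exists>!h. h \<in> Hom C Q' B \<and> h \<cdot> q = f)"
    using assms(1) by (auto simp: regular_epi_def is_coequalizer_def)
  moreover have "X' = X" "Q' = Q" using c(3) assms(2) by (auto simp: Hom_def)
  ultimately show thesis using that by blast
qed

lemma regular_epi_cancel:
  assumes "regular_epi C q" "q \<in> Hom C X Q" "f \<in> Hom C Q B" "g \<in> Hom C Q B" "f \<cdot> q = g \<cdot> q"
  shows "f = g"
proof -
  obtain u W v where c: "u \<in> Hom C W X" "v \<in> Hom C W X" "q \<cdot> u = q \<cdot> v"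
    "\<forall>B. \<forall>f\<in>Hom C X B. f \<cdot> u = f \<cdot> v \<longrightarrow> (\<exists>!h. h \<in> Hom C Q B \<and> h \<cdot> q = f)"
    using regular_epi_coequalizer[OF assms(1,2)] by blast
  have "f \<cdot> q \<in> Hom C X B" using assms Cmp_in_Hom by blast
  moreover have "(f \<cdot> q) \<cdot> u = (f \<cdot> q) \<cdot> v"
    using Cmp_assoc[OF c(1) assms(2,3)] Cmp_assoc[OF c(2) assms(2,3)] c(3) by simp
  ultimately show ?thesis using c(4) assms(3-5) by metis
qed

text \<open>Since \<open>m\<close> is monic, \<open>k\<close> coequalizes the pair whose coequalizer
  is \<open>e\<close>, so it descends along \<open>e\<close>; cancelling \<open>e\<close> then gives
  the triangle with \<open>g\<close>. This orthogonality lets factorizations through a monomorphism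
  descend from a cover to its base.\<close>

lemma regular_epi_mono_diagonal:
  assumes e: "regular_epi C e" "e \<in> Hom C B A" and m: "mono_arrow C m" "m \<in> Hom C I Y"
    and g: "g \<in> Hom C A Y" and k: "k \<in> Hom C B I" and eq: "m \<cdot> k = g \<cdot> e"
  shows "\<exists>h\<in>Hom C A I. m \<cdot> h = g"
proof -
  obtain u W v where c: "u \<in> Hom C W B" "v \<in> Hom C W B" "e \<cdot> u = e \<cdot> v"
    "\<forall>B'. \<forall>f\<in>Hom C B B'. f \<cdot> u = f \<cdot> v \<longrightarrow> (\<exists>!h. h \<in> Hom C A B' \<and> h \<cdot> e = f)"
    using regular_epi_coequalizer[OF e] by blast
  have "m \<cdot> (k \<cdot> u) = m \<cdot> (k \<cdot> v)"
    by (metis Cmp_assoc[OF c(1) k m(2)] Cmp_assoc[OF c(2) k m(2)]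
        Cmp_assoc[OF c(1) e(2) g] Cmp_assoc[OF c(2) e(2) g] c(3) eq)
  hence "k \<cdot> u = k \<cdot> v"
    using mono_arrowD[OF m] Cmp_in_Hom c(1,2) k by blast
  then obtain h where h: "h \<in> Hom C A I" "h \<cdot> e = k" using c(4) k by blast
  have "(m \<cdot> h) \<cdot> e = g \<cdot> e" using Cmp_assoc[OF e(2) h(1) m(2)] h(2) eq by simp
  hence "m \<cdot> h = g" using regular_epi_cancel[OF e _ g] Cmp_in_Hom[OF h(1) m(2)] by blast
  thus ?thesis using h(1) by blast
qed

lemma regular_epi_Idn:
  assumes "X \<in> Ob C" shows "regular_epi C (Idn C X)"
proof -
  have "is_coequalizer C (Idn C X) (Idn C X) (Idn C X)"
    unfolding is_coequalizer_def
    using Idn_in_Hom[OF assms] Idn_right by (intro exI[of _ X]) metis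
  thus ?thesis by (auto simp: regular_epi_def)
qed

text \<open>A monomorphism with a right inverse is invertible, so \<open>m \<cdot> q\<close> is a
  coequalizer of the same pair as \<open>q\<close>. Together with images this recognizes regular
  epimorphisms: it is enough to lift the identity through the image.\<close>

lemma regular_epi_split_mono_comp:
  assumes q: "regular_epi C q" "q \<in> Hom C X I" and m: "mono_arrow C m" "m \<in> Hom C I Y"
    and k: "k \<in> Hom C Y I" "m \<cdot> k = Idn C Y"
  shows "regular_epi C (m \<cdot> q)"
proof -
  have Y: "Y \<in> Ob C" and I: "I \<in> Ob C" using m Hom_Ob by auto
  have "m \<cdot> (k \<cdot> m) = m \<cdot> Idn C I"
    using Cmp_assoc[OF m(2) k(1) m(2)] k(2) Idn_left[OF m(2)] Idn_right[OF m(2)] by simp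
  hence km: "k \<cdot> m = Idn C I"
    using mono_arrowD[OF m] Cmp_in_Hom[OF m(2) k(1)] Idn_in_Hom[OF I] by blast
  obtain u W v where c: "u \<in> Hom C W X" "v \<in> Hom C W X" "q \<cdot> u = q \<cdot> v"
    "\<forall>B. \<forall>f\<in>Hom C X B. f \<cdot> u = f \<cdot> v \<longrightarrow> (\<exists>!h. h \<in> Hom C I B \<and> h \<cdot> q = f)"
    using regular_epi_coequalizer[OF q] by blast
  have "is_coequalizer C u v (m \<cdot> q)"
    unfolding is_coequalizer_def
  proof (intro exI conjI allI ballI impI)
    show "u \<in> Hom C W X" "v \<in> Hom C W X" by fact+
    show "m \<cdot> q \<in> Hom C X Y" using q m Cmp_in_Hom by blast
    show "(m \<cdot> q) \<cdot> u = (m \<cdot> q) \<cdot> v"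
      using Cmp_assoc[OF c(1) q(2) m(2)] Cmp_assoc[OF c(2) q(2) m(2)] c(3) by simp
    fix B f assume f: "f \<in> Hom C X B" "f \<cdot> u = f \<cdot> v"
    then obtain h where h: "h \<in> Hom C I B" "h \<cdot> q = f" using c(4) by blast
    show "\<exists>!h. h \<in> Hom C Y B \<and> h \<cdot> (m \<cdot> q) = f"
    proof (rule ex1I)
      have "(h \<cdot> k) \<cdot> (m \<cdot> q) = ((h \<cdot> k) \<cdot> m) \<cdot> q"
        using Cmp_assoc[OF q(2) m(2)] Cmp_in_Hom[OF k(1) h(1)] by simp
      also have "\<dots> = f" using Cmp_assoc[OF m(2) k(1) h(1)] km Idn_right[OF h(1)] h(2) by simp
      finally show "h \<cdot> k \<in> Hom C Y B \<and> (h \<cdot> k) \<cdot> (m \<cdot> q) = f"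
        using Cmp_in_Hom[OF k(1) h(1)] by simp
    next
      fix g assume g: "g \<in> Hom C Y B \<and> g \<cdot> (m \<cdot> q) = f"
      hence gm: "g \<cdot> m \<in> Hom C I B" using m Cmp_in_Hom by blast
      have "(g \<cdot> m) \<cdot> q = h \<cdot> q" using Cmp_assoc[OF q(2) m(2), of g B] g h by simp
      hence "g \<cdot> m = h" using regular_epi_cancel[OF q gm h(1)] by blast
      thus "g = h \<cdot> k" using Cmp_assoc[OF k(1) m(2), of g B] k(2) Idn_right[of g] g by auto
    qed
  qed
  thus ?thesis by (auto simp: regular_epi_def)
qed

end

text \<open>The objects hidden in the existential of \<open>is_pullback\<close> are recovered from
  the given typings, because an arrow lies in only one hom-set.\<close>

lemma is_pullbackD:
  assumes "is_pullback C f g p1 p2" "f \<in> Hom C X Z" "g \<in> Hom C Y Z"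
  shows "\<exists>P. p1 \<in> Hom C P X \<and> p2 \<in> Hom C P Y \<and> f \<cdot>\<^bsub>C\<^esub> p1 = g \<cdot>\<^bsub>C\<^esub> p2 \<and>
    (\<forall>A. \<forall>a\<in>Hom C A X. \<forall>b\<in>Hom C A Y. f \<cdot>\<^bsub>C\<^esub> a = g \<cdot>\<^bsub>C\<^esub> b \<longrightarrow>
           (\<exists>!h. h \<in> Hom C A P \<and> p1 \<cdot>\<^bsub>C\<^esub> h = a \<and> p2 \<cdot>\<^bsub>C\<^esub> h = b))"
proof -
  obtain X' Y' Z' P where P: "f \<in> Hom C X' Z'" "g \<in> Hom C Y' Z'" "p1 \<in> Hom C P X'" "p2 \<in> Hom C P Y'"
    "f \<cdot>\<^bsub>C\<^esub> p1 = g \<cdot>\<^bsub>C\<^esub> p2"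
    "\<forall>A. \<forall>a\<in>Hom C A X'. \<forall>b\<in>Hom C A Y'. f \<cdot>\<^bsub>C\<^esub> a = g \<cdot>\<^bsub>C\<^esub> b \<longrightarrow>
           (\<exists>!h. h \<in> Hom C A P \<and> p1 \<cdot>\<^bsub>C\<^esub> h = a \<and> p2 \<cdot>\<^bsub>C\<^esub> h = b)"
    using assms(1) unfolding is_pullback_def by blast
  moreover have "X' = X" "Y' = Y" using P(1,2) assms(2,3) by (auto simp: Hom_def)
  ultimately show ?thesis by (intro exI[of _ P] conjI) simp_all
qed

lemma is_coequalizerD:
  assumes "is_coequalizer C u v q" "u \<in> Hom C W X"
  shows "\<exists>Q. q \<in> Hom C X Q \<and> q \<cdot>\<^bsub>C\<^esub> u = q \<cdot>\<^bsub>C\<^esub> v \<and>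
    (\<forall>B. \<forall>f\<in>Hom C X B. f \<cdot>\<^bsub>C\<^esub> u = f \<cdot>\<^bsub>C\<^esub> v \<longrightarrow>
           (\<exists>!h. h \<in> Hom C Q B \<and> h \<cdot>\<^bsub>C\<^esub> q = f))"
proof -
  obtain W' X' Q where Q: "u \<in> Hom C W' X'" "q \<in> Hom C X' Q" "q \<cdot>\<^bsub>C\<^esub> u = q \<cdot>\<^bsub>C\<^esub> v"
    "\<forall>B. \<forall>f\<in>Hom C X' B. f \<cdot>\<^bsub>C\<^esub> u = f \<cdot>\<^bsub>C\<^esub> v \<longrightarrow>
           (\<exists>!h. h \<in> Hom C Q B \<and> h \<cdot>\<^bsub>C\<^esub> q = f)"
    using assms(1) unfolding is_coequalizer_def by blast
  moreover have "X' = X" using Q(1) assms(2) by (auto simp: Hom_def)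
  ultimately show ?thesis by (intro exI[of _ Q] conjI) simp_all
qed

section \<open>Finite limits, pullbacks and squares of objects\<close>

context finitely_complete_category
begin

text \<open>The axiom provides limits for vertices of type \<open>nat\<close>; an injection
  \<open>g\<close> of \<open>V\<close> into \<open>nat\<close>, with inverse \<open>r\<close>,
  carries diagrams and cones over. The diagrams of the Chinese Remainder condition need this, as
  their vertices are pairs.\<close>

lemma limit_exists:
  fixes V :: "'v set"
  assumes V: "finite V" and E: "finite E" and diag: "is_diagram C V D E"
  shows "\<exists>L p. is_limit C V D E L p"
proof -
  obtain g :: "'v \<Rightarrow> nat" where g: "inj_on g V"
    using finite_imp_inj_to_nat_seg[OF V] by blast
  define r where "r = inv_into V g"
  have rg: "r (g v) = v" if "v \<in> V" for v using g that by (simp add: r_def)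
  define E' where "E' = (\<lambda>(u, v, f). (g u, g v, f)) ` E"
  have "is_diagram C (g ` V) (D \<circ> r) E'"
    using diag by (fastforce simp: is_diagram_def E'_def rg)
  then obtain L p where L: "is_limit C (g ` V) (D \<circ> r) E' L p"
    using finite_limits[of "g ` V" E' "D \<circ> r"] V E by (auto simp: E'_def)
  have EV: "u \<in> V \<and> v \<in> V" if "(u, v, f) \<in> E" for u v f
    using diag that by (auto simp: is_diagram_def)
  \<comment> \<open>Cones correspond in both directions: along \<open>g\<close> for the limit cone
    itself, along \<open>r\<close> for a competing cone.\<close>
  have cone: "is_cone C V D E A (b \<circ> g) \<longleftrightarrow> is_cone C (g ` V) (D \<circ> r) E' A b" for A b
    by (auto simp: is_cone_def E'_def rg split_beta)
  have cone': "is_cone C V D E A a \<longleftrightarrow> is_cone C (g ` V) (D \<circ> r) E' A (a \<circ> r)" for A a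
    using EV by (force simp: is_cone_def E'_def rg split_beta)
  have "is_limit C V D E L (p \<circ> g)"
    unfolding is_limit_def
  proof (intro conjI allI impI)
    show "is_cone C V D E L (p \<circ> g)" using L cone by (simp add: is_limit_def)
    fix A a assume "is_cone C V D E A a"
    hence "\<exists>!h. h \<in> Hom C A L \<and> (\<forall>v\<in>g ` V. p v \<cdot> h = (a \<circ> r) v)"
      using L cone' unfolding is_limit_def by blast
    thus "\<exists>!h. h \<in> Hom C A L \<and> (\<forall>v\<in>V. (p \<circ> g) v \<cdot> h = a v)"
      by (simp add: rg)
  qed
  thus ?thesis by blast
qed

lemma pullback_exists:
  assumes f: "f \<in> Hom C X Z" and g: "g \<in> Hom C Y Z"
  shows "\<exists>P p1 p2. is_pullback C f g p1 p2 \<and> p1 \<in> Hom C P X \<and> p2 \<in> Hom C P Y \<and>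
    f \<cdot> p1 = g \<cdot> p2 \<and>
    (\<forall>A. \<forall>a\<in>Hom C A X. \<forall>b\<in>Hom C A Y. f \<cdot> a = g \<cdot> b \<longrightarrow>
       (\<exists>h\<in>Hom C A P. p1 \<cdot> h = a \<and> p2 \<cdot> h = b))"
proof -
  define D where "D = (\<lambda>v::nat. if v = 0 then X else if v = 1 then Y else Z)"
  let ?V = "{0::nat, 1, 2}" and ?E = "{(0::nat, 2::nat, f), (1, 2, g)}"
  have "is_diagram C ?V D ?E" using f g Hom_Ob by (auto simp: is_diagram_def D_def)
  then obtain P p where L: "is_limit C ?V D ?E P p" using limit_exists[of ?V ?E D] by auto
  hence p: "p 0 \<in> Hom C P X" "p 1 \<in> Hom C P Y" "f \<cdot> p 0 = p 2" "g \<cdot> p 1 = p 2" 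
    by (auto simp: is_limit_def is_cone_def D_def)
  have univ: "\<exists>!h. h \<in> Hom C A P \<and> p 0 \<cdot> h = a \<and> p 1 \<cdot> h = b"
    if ab: "a \<in> Hom C A X" "b \<in> Hom C A Y" "f \<cdot> a = g \<cdot> b" for A a b
  proof -
    let ?a = "\<lambda>v::nat. if v = 0 then a else if v = 1 then b else f \<cdot> a"
    have "is_cone C ?V D ?E A ?a"
      using ab Hom_Ob[OF ab(1)] Cmp_in_Hom[OF ab(1) f] by (auto simp: is_cone_def D_def)
    hence ex: "\<exists>!h. h \<in> Hom C A P \<and> (\<forall>v\<in>?V. p v \<cdot> h = ?a v)"
      using L unfolding is_limit_def by blast
    \<comment> \<open>The leg to the corner, vertex 2, is determined by the leg at vertex 0, so the
      equation there adds no condition on \<open>h\<close>.\<close>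
    have "p 2 \<cdot> h = f \<cdot> a" if "h \<in> Hom C A P" "p 0 \<cdot> h = a" for h
      using Cmp_assoc[OF that(1) p(1) f] p(3) that(2) by simp
    hence "(h \<in> Hom C A P \<and> (\<forall>v\<in>?V. p v \<cdot> h = ?a v))
        = (h \<in> Hom C A P \<and> p 0 \<cdot> h = a \<and> p 1 \<cdot> h = b)" for h by auto
    thus ?thesis using ex by simp
  qed
  have "is_pullback C f g (p 0) (p 1)"
    unfolding is_pullback_def
    by (intro exI[of _ X] exI[of _ Y] exI[of _ Z] exI[of _ P]) (use f g p univ in auto)
  moreover have "f \<cdot> p 0 = g \<cdot> p 1" using p by simp
  moreover have "\<forall>A. \<forall>a\<in>Hom C A X. \<forall>b\<in>Hom C A Y. f \<cdot> a = g \<cdot> b \<longrightarrow>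
       (\<exists>h\<in>Hom C A P. p 0 \<cdot> h = a \<and> p 1 \<cdot> h = b)"
    using univ by blast
  ultimately show ?thesis using p(1,2) by (intro exI[of _ P] exI[of _ "p 0"] exI[of _ "p 1"] conjI)
qed

lemma product_exists:
  assumes "X \<in> Ob C" "Y \<in> Ob C"
  shows "\<exists>p1 p2. is_product C X Y p1 p2"
proof -
  define D where "D = (\<lambda>v::nat. if v = 0 then X else Y)"
  let ?V = "{0::nat, 1}"
  have "is_diagram C ?V D {}" using assms by (auto simp: is_diagram_def D_def)
  then obtain P p where L: "is_limit C ?V D {} P p" using limit_exists[of ?V "{}" D] by auto
  hence p: "p 0 \<in> Hom C P X" "p 1 \<in> Hom C P Y"
    by (auto simp: is_limit_def is_cone_def D_def)
  have univ: "\<exists>!h. h \<in> Hom C A P \<and> p 0 \<cdot> h = a \<and> p 1 \<cdot> h = b"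
    if ab: "a \<in> Hom C A X" "b \<in> Hom C A Y" for A a b
  proof -
    let ?a = "\<lambda>v::nat. if v = 0 then a else b"
    have "is_cone C ?V D {} A ?a"
      using ab Hom_Ob[OF ab(1)] by (auto simp: is_cone_def D_def)
    hence ex: "\<exists>!h. h \<in> Hom C A P \<and> (\<forall>v\<in>?V. p v \<cdot> h = ?a v)"
      using L unfolding is_limit_def by blast
    thus ?thesis by simp
  qed
  thus ?thesis unfolding is_product_def using p by blast
qed

lemma sq_proj_product:
  assumes "X \<in> Ob C" shows "is_product C X X (pr1 C X) (pr2 C X)"
proof -
  obtain p1 p2 where "is_product C X X (fst (p1, p2)) (snd (p1, p2))"
    using product_exists[OF assms assms] by auto
  hence "is_product C X X (fst (sq_proj C X)) (snd (sq_proj C X))"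
    unfolding sq_proj_def by (rule someI)
  thus ?thesis by (simp add: pr1_def pr2_def)
qed

lemma pr_hom:
  assumes "X \<in> Ob C"
  shows "pr1 C X \<in> Hom C (sq_obj C X) X" "pr2 C X \<in> Hom C (sq_obj C X) X"
  using sq_proj_product[OF assms] by (auto simp: is_product_def sq_obj_def Hom_def)

lemma sq_pairing:
  assumes "x \<in> Hom C A X" "y \<in> Hom C A X"
  shows "\<exists>!h. h \<in> Hom C A (sq_obj C X) \<and> pr1 C X \<cdot> h = x \<and> pr2 C X \<cdot> h = y"
proof -
  have X: "X \<in> Ob C" using assms Hom_Ob by blast
  obtain P where P: "pr1 C X \<in> Hom C P X"
    "\<forall>A. \<forall>f\<in>Hom C A X. \<forall>g\<in>Hom C A X.
           \<exists>!h. h \<in> Hom C A P \<and> pr1 C X \<cdot> h = f \<and> pr2 C X \<cdot> h = g"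
    using sq_proj_product[OF X] by (auto simp: is_product_def)
  have "P = sq_obj C X" using P(1) by (simp add: sq_obj_def Hom_def)
  thus ?thesis using P(2) assms by blast
qed

lemma sq_eqI:
  assumes "X \<in> Ob C" "h \<in> Hom C A (sq_obj C X)" "k \<in> Hom C A (sq_obj C X)"
    "pr1 C X \<cdot> h = pr1 C X \<cdot> k" "pr2 C X \<cdot> h = pr2 C X \<cdot> k"
  shows "h = k"
proof -
  have "pr1 C X \<cdot> k \<in> Hom C A X" "pr2 C X \<cdot> k \<in> Hom C A X"
    using assms(3) pr_hom[OF assms(1)] Cmp_in_Hom by blast+
  thus ?thesis using sq_pairing[of "pr1 C X \<cdot> k" A X "pr2 C X \<cdot> k"] assms by blast
qed

end

section \<open>Regular epimorphisms in a regular category\<close>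

context regular_category
begin

text \<open>Pulling \<open>f\<close> back along \<open>y\<close> gives the cover \<open>e\<close>, a
  regular epimorphism by stability. This is the form in which local existence is used.\<close>

lemma regular_epi_lift:
  assumes "regular_epi C f" "f \<in> Hom C X Y" "y \<in> Hom C A Y"
  obtains B e x where "regular_epi C e" "e \<in> Hom C B A" "x \<in> Hom C B X" "f \<cdot> x = y \<cdot> e"
proof -
  obtain P p1 p2 where P: "is_pullback C f y p1 p2" "p1 \<in> Hom C P X" "p2 \<in> Hom C P A"
    "f \<cdot> p1 = y \<cdot> p2"
    using pullback_exists[OF assms(2,3)] by (elim exE conjE)
  show thesis using that[OF regular_epi_stable[OF assms(1) P(1)] P(3,2,4)] .
qed

text \<open>Equal images under \<open>f\<close> give a factorization through its kernel pair, which
  \<open>q\<close> coequalizes.\<close>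

lemma kernel_pair_quotient_eq:
  assumes kp: "is_kernel_pair C f k1 k2" and f: "f \<in> Hom C X Y" and q: "q \<in> Hom C X Q"
    and qk: "q \<cdot> k1 = q \<cdot> k2"
    and a: "a \<in> Hom C A X" "b \<in> Hom C A X" "f \<cdot> a = f \<cdot> b"
  shows "q \<cdot> a = q \<cdot> b"
proof -
  obtain P where P: "k1 \<in> Hom C P X" "k2 \<in> Hom C P X"
    "\<forall>A. \<forall>a\<in>Hom C A X. \<forall>b\<in>Hom C A X. f \<cdot> a = f \<cdot> b \<longrightarrow>
           (\<exists>!h. h \<in> Hom C A P \<and> k1 \<cdot> h = a \<and> k2 \<cdot> h = b)"
    using is_pullbackD[OF kp[unfolded is_kernel_pair_def] f f] by (elim exE conjE)
  obtain h where h: "h \<in> Hom C A P" "k1 \<cdot> h = a" "k2 \<cdot> h = b" using P(3) a by blast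
  show ?thesis using Cmp_assoc[OF h(1) P(1) q] Cmp_assoc[OF h(1) P(2) q] qk h by simp
qed

text \<open>\<open>q\<close> is the coequalizer of the kernel pair of \<open>f\<close>, and
  \<open>m\<close> is the induced arrow. To see that \<open>m\<close> is monic, two arrows that it
  identifies are lifted locally along \<open>q\<close>; the lifts have equal images under
  \<open>f\<close>, hence under \<open>q\<close>.\<close>

lemma regular_image:
  assumes f: "f \<in> Hom C X Y"
  obtains I q m where "regular_epi C q" "q \<in> Hom C X I" "mono_arrow C m" "m \<in> Hom C I Y"
    "m \<cdot> q = f"
proof -
  obtain P k1 k2 where kp: "is_pullback C f f k1 k2" "k1 \<in> Hom C P X" "k2 \<in> Hom C P X"
    "f \<cdot> k1 = f \<cdot> k2"
    using pullback_exists[OF f f] by (elim exE conjE)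
  obtain q where q: "is_coequalizer C k1 k2 q"
    using kernel_pair_coequalizer[OF kp(1)[folded is_kernel_pair_def]] by blast
  obtain I where I: "q \<in> Hom C X I" "q \<cdot> k1 = q \<cdot> k2"
    "\<forall>B. \<forall>f\<in>Hom C X B. f \<cdot> k1 = f \<cdot> k2 \<longrightarrow> (\<exists>!h. h \<in> Hom C I B \<and> h \<cdot> q = f)"
    using is_coequalizerD[OF q kp(2)] by (elim exE conjE)
  have req: "regular_epi C q" using q by (auto simp: regular_epi_def)
  obtain m where m: "m \<in> Hom C I Y" "m \<cdot> q = f" using I(3) f kp(4) by blast
  have "mono_arrow C m"
  proof (rule mono_arrowI[OF m(1)])
    fix A u v assume uv: "u \<in> Hom C A I" "v \<in> Hom C A I" "m \<cdot> u = m \<cdot> v"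
    obtain B e x where e: "regular_epi C e" "e \<in> Hom C B A" "x \<in> Hom C B X" "q \<cdot> x = u \<cdot> e"
      using regular_epi_lift[OF req I(1) uv(1)] .
    have ve: "v \<cdot> e \<in> Hom C B I" "u \<cdot> e \<in> Hom C B I" using Cmp_in_Hom e(2) uv by blast+
    \<comment> \<open>The second lift is taken over the cover of the first, so that both can be
      compared on \<open>D\<close>.\<close>
    obtain D d y where d: "regular_epi C d" "d \<in> Hom C D B" "y \<in> Hom C D X"
      "q \<cdot> y = (v \<cdot> e) \<cdot> d"
      using regular_epi_lift[OF req I(1) ve(1)] .
    have xd: "x \<cdot> d \<in> Hom C D X" using Cmp_in_Hom d(2) e(3) by blast
    have qxd: "q \<cdot> (x \<cdot> d) = (u \<cdot> e) \<cdot> d" using Cmp_assoc[OF d(2) e(3) I(1)] e(4) by simp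
    have "f \<cdot> (x \<cdot> d) = m \<cdot> ((u \<cdot> e) \<cdot> d)" using Cmp_assoc[OF xd I(1) m(1)] m(2) qxd by simp
    also have "\<dots> = (m \<cdot> (u \<cdot> e)) \<cdot> d" using Cmp_assoc[OF d(2) ve(2) m(1)] by simp
    also have "m \<cdot> (u \<cdot> e) = m \<cdot> (v \<cdot> e)"
      using Cmp_assoc[OF e(2) uv(1) m(1)] Cmp_assoc[OF e(2) uv(2) m(1)] uv(3) by simp
    also have "(m \<cdot> (v \<cdot> e)) \<cdot> d = m \<cdot> ((v \<cdot> e) \<cdot> d)" using Cmp_assoc[OF d(2) ve(1) m(1)] by simp
    also have "\<dots> = f \<cdot> y" using Cmp_assoc[OF d(3) I(1) m(1)] m(2) d(4) by simp
    finally have "q \<cdot> (x \<cdot> d) = q \<cdot> y"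
      using kernel_pair_quotient_eq[OF kp(1)[folded is_kernel_pair_def] f I(1,2) xd d(3)] by blast
    hence "(u \<cdot> e) \<cdot> d = (v \<cdot> e) \<cdot> d" using qxd d(4) by simp
    hence "u \<cdot> e = v \<cdot> e" using regular_epi_cancel[OF d(1,2)] ve by blast
    thus "u = v" using regular_epi_cancel[OF e(1,2)] uv by blast
  qed
  thus thesis using that[OF req I(1) _ m] by blast
qed

text \<open>The regular epimorphism \<open>f \<cdot> x\<close> factors through the image
  \<open>m\<close> of \<open>f\<close>; orthogonality lifts the identity of \<open>Y\<close> through
  \<open>m\<close>, so \<open>m\<close> is invertible.\<close>

lemma regular_epi_of_factor:
  assumes f: "f \<in> Hom C X Y" and x: "x \<in> Hom C B X" and fx: "regular_epi C (f \<cdot> x)"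
  shows "regular_epi C f"
proof -
  obtain I q m where i: "regular_epi C q" "q \<in> Hom C X I" "mono_arrow C m" "m \<in> Hom C I Y"
    "m \<cdot> q = f" using regular_image[OF f] .
  have Y: "Idn C Y \<in> Hom C Y Y" using Idn_in_Hom Hom_Ob f by blast
  have fxh: "f \<cdot> x \<in> Hom C B Y" using f x Cmp_in_Hom by blast
  have qx: "q \<cdot> x \<in> Hom C B I" using x i Cmp_in_Hom by blast
  have "m \<cdot> (q \<cdot> x) = Idn C Y \<cdot> (f \<cdot> x)"
    using Cmp_assoc[OF x i(2,4)] i(5) Idn_left[OF fxh] by simp
  then obtain k where "k \<in> Hom C Y I" "m \<cdot> k = Idn C Y"
    using regular_epi_mono_diagonal[OF fx fxh i(3,4) Y qx] by blast
  thus ?thesis using regular_epi_split_mono_comp[OF i(1-4)] i(5) by simp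
qed

text \<open>No pair with coequalizer \<open>e \<cdot> d\<close> is at hand. Instead orthogonality is
  applied twice to the image \<open>m\<close> of the composite: along \<open>d\<close> it factors
  \<open>e\<close> through \<open>m\<close>, along \<open>e\<close> it factors the identity.\<close>

lemma regular_epi_comp:
  assumes d: "regular_epi C d" "d \<in> Hom C D B" and e: "regular_epi C e" "e \<in> Hom C B A"
  shows "regular_epi C (e \<cdot> d)"
proof -
  have ed: "e \<cdot> d \<in> Hom C D A" using d e Cmp_in_Hom by blast
  obtain I q m where i: "regular_epi C q" "q \<in> Hom C D I" "mono_arrow C m" "m \<in> Hom C I A"
    "m \<cdot> q = e \<cdot> d" using regular_image[OF ed] .
  obtain h where h: "h \<in> Hom C B I" "m \<cdot> h = e"
    using regular_epi_mono_diagonal[OF d i(3,4) e(2) i(2,5)] by blast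
  have A: "Idn C A \<in> Hom C A A" using Idn_in_Hom Hom_Ob e by blast
  obtain k where "k \<in> Hom C A I" "m \<cdot> k = Idn C A"
    using regular_epi_mono_diagonal[OF e i(3,4) A h(1)] h(2) Idn_left[OF e(2)] by auto
  thus ?thesis using regular_epi_split_mono_comp[OF i(1-4)] i(5) by simp
qed

end


section \<open>Relations on generalized elements\<close>

text \<open>Membership of the generalized element \<open>(x, y)\<close> in the subobject
  \<open>r\<close> of the square, at stage \<open>Dom C x\<close>. The type of \<open>y\<close>
  comes from the factorization (\<open>rel_mem_hom\<close>).\<close>

definition rel_mem :: "('o, 'm, 'z) cat_scheme \<Rightarrow> 'o \<Rightarrow> 'm \<Rightarrow> 'm \<Rightarrow> 'm \<Rightarrow> bool" where
  "rel_mem C X r x y \<longleftrightarrow>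
     (\<exists>h\<in>Hom C (Dom C x) (Dom C r). leg1 C X r \<cdot>\<^bsub>C\<^esub> h = x \<and> leg2 C X r \<cdot>\<^bsub>C\<^esub> h = y)"

context finitely_complete_category
begin

lemma is_relationD:
  assumes "is_relation C X r"
  shows "X \<in> Ob C" "mono_arrow C r" "r \<in> Hom C (Dom C r) (sq_obj C X)"
    "leg1 C X r \<in> Hom C (Dom C r) X" "leg2 C X r \<in> Hom C (Dom C r) X"
proof -
  show X: "X \<in> Ob C" "mono_arrow C r" and r: "r \<in> Hom C (Dom C r) (sq_obj C X)"
    using assms by (auto simp: is_relation_def mono_arrow_def Hom_def)
  show "leg1 C X r \<in> Hom C (Dom C r) X" "leg2 C X r \<in> Hom C (Dom C r) X"
    using Cmp_in_Hom[OF r] pr_hom[OF X(1)] by (auto simp: leg1_def leg2_def)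
qed

lemma rel_mem_iff:
  assumes r: "is_relation C X r" and x: "x \<in> Hom C A X"
  shows "rel_mem C X r x y \<longleftrightarrow>
    (\<exists>h\<in>Hom C A (Dom C r). pr1 C X \<cdot> (r \<cdot> h) = x \<and> pr2 C X \<cdot> (r \<cdot> h) = y)"
proof -
  have "leg1 C X r \<cdot> h = pr1 C X \<cdot> (r \<cdot> h) \<and> leg2 C X r \<cdot> h = pr2 C X \<cdot> (r \<cdot> h)"
    if "h \<in> Hom C A (Dom C r)" for h
    using Cmp_assoc[OF that is_relationD(3)[OF r]] pr_hom[OF is_relationD(1)[OF r]]
    by (simp add: leg1_def leg2_def)
  thus ?thesis using Hom_Dom[OF x] by (auto simp: rel_mem_def)
qed

text \<open>With the pair packaged as one arrow \<open>p\<close> into the square, membership becomes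
  factorization through the monomorphism \<open>r\<close>, to which orthogonality and pullbacks
  apply.\<close>

lemma rel_mem_pairing:
  assumes r: "is_relation C X r" and x: "x \<in> Hom C A X"
    and p: "p \<in> Hom C A (sq_obj C X)" "pr1 C X \<cdot> p = x" "pr2 C X \<cdot> p = y"
  shows "rel_mem C X r x y \<longleftrightarrow> (\<exists>h\<in>Hom C A (Dom C r). r \<cdot> h = p)"
  unfolding rel_mem_iff[OF r x] using p(2,3)
    sq_eqI[OF is_relationD(1)[OF r] _ p(1)] Cmp_in_Hom[OF _ is_relationD(3)[OF r], of _ A]
  by metis

text \<open>The legs are the generic element of \<open>r\<close>, witnessed by the identity of
  \<open>Dom C r\<close>.\<close>

lemma rel_mem_legs:
  assumes "is_relation C X r" shows "rel_mem C X r (leg1 C X r) (leg2 C X r)"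
  unfolding rel_mem_def
  using is_relationD[OF assms] Idn_in_Hom[of "Dom C r"] Hom_Ob Idn_right Hom_Dom by metis

lemma rel_mem_hom:
  assumes "is_relation C X r" "rel_mem C X r x y" "x \<in> Hom C A X"
  shows "y \<in> Hom C A X"
proof -
  obtain h where "h \<in> Hom C A (Dom C r)" "leg2 C X r \<cdot> h = y"
    using assms(2,3) by (auto simp: rel_mem_def Hom_Dom)
  thus ?thesis using Cmp_in_Hom is_relationD(5)[OF assms(1)] by blast
qed

lemma rel_mem_comp:
  assumes r: "is_relation C X r" and m: "rel_mem C X r x y"
    and x: "x \<in> Hom C A X" and e: "e \<in> Hom C B A"
  shows "rel_mem C X r (x \<cdot> e) (y \<cdot> e)"
proof -
  obtain h where h: "h \<in> Hom C A (Dom C r)" "leg1 C X r \<cdot> h = x" "leg2 C X r \<cdot> h = y"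
    using m x by (auto simp: rel_mem_def Hom_Dom)
  have "leg1 C X r \<cdot> (h \<cdot> e) = x \<cdot> e \<and> leg2 C X r \<cdot> (h \<cdot> e) = y \<cdot> e"
    using Cmp_assoc[OF e h(1)] is_relationD(4,5)[OF r] h(2,3) by metis
  thus ?thesis using Cmp_in_Hom[OF e h(1)] Hom_Dom[OF Cmp_in_Hom[OF e x]]
    unfolding rel_mem_def by auto
qed

text \<open>A Yoneda argument: an inclusion acts on elements by composition, and conversely it is
  read off from the implication at the generic element of \<open>r\<close>.\<close>

lemma sub_le_iff_rel_mem:
  assumes r: "is_relation C X r" and s: "is_relation C X s"
  shows "sub_le C r s \<longleftrightarrow>
    (\<forall>A. \<forall>x\<in>Hom C A X. \<forall>y\<in>Hom C A X. rel_mem C X r x y \<longrightarrow> rel_mem C X s x y)"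
proof
  assume "sub_le C r s"
  then obtain m where m: "m \<in> Hom C (Dom C r) (Dom C s)" "s \<cdot> m = r" by (auto simp: sub_le_def)
  show "\<forall>A. \<forall>x\<in>Hom C A X. \<forall>y\<in>Hom C A X. rel_mem C X r x y \<longrightarrow> rel_mem C X s x y"
  proof (intro allI ballI impI)
    fix A x y assume x: "x \<in> Hom C A X" and "rel_mem C X r x y"
    then obtain h where h: "h \<in> Hom C A (Dom C r)" "pr1 C X \<cdot> (r \<cdot> h) = x" "pr2 C X \<cdot> (r \<cdot> h) = y"
      using rel_mem_iff[OF r x] by blast
    have "s \<cdot> (m \<cdot> h) = r \<cdot> h" using Cmp_assoc[OF h(1) m(1) is_relationD(3)[OF s]] m(2) by simp
    thus "rel_mem C X s x y"
      unfolding rel_mem_iff[OF s x] using h Cmp_in_Hom[OF h(1) m(1)] by metis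
  qed
next
  assume "\<forall>A. \<forall>x\<in>Hom C A X. \<forall>y\<in>Hom C A X. rel_mem C X r x y \<longrightarrow> rel_mem C X s x y"
  hence "rel_mem C X s (leg1 C X r) (leg2 C X r)"
    using is_relationD[OF r] rel_mem_legs[OF r] by blast
  thus "sub_le C r s"
    using rel_mem_pairing[OF s is_relationD(4)[OF r] is_relationD(3)[OF r]]
    by (simp add: leg1_def leg2_def sub_le_def)
qed

lemma reflexive_rel_iff: 
  assumes "X \<in> Ob C"
  shows "reflexive_rel C X r \<longleftrightarrow> rel_mem C X r (Idn C X) (Idn C X)"
  using Hom_Dom[OF Idn_in_Hom[OF assms]] by (auto simp: rel_mem_def reflexive_rel_def)

lemma equivalence_relD: "equivalence_rel C X r \<Longrightarrow> is_relation C X r"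
  by (simp add: equivalence_rel_def)

lemma rel_mem_refl:
  assumes r: "equivalence_rel C X r" and x: "x \<in> Hom C A X"
  shows "rel_mem C X r x x"
proof -
  have X: "X \<in> Ob C" using x Hom_Ob by blast
  have "rel_mem C X r (Idn C X) (Idn C X)"
    using r reflexive_rel_iff[OF X] by (simp add: equivalence_rel_def)
  thus ?thesis using rel_mem_comp[OF equivalence_relD[OF r] _ Idn_in_Hom[OF X] x] Idn_left[OF x]
    by metis
qed

lemma rel_mem_sym:
  assumes r: "equivalence_rel C X r" and x: "x \<in> Hom C A X" and m: "rel_mem C X r x y"
  shows "rel_mem C X r y x"
proof -
  note R = is_relationD[OF equivalence_relD[OF r]]
  obtain t where t: "t \<in> Hom C (Dom C r) (Dom C r)" "leg1 C X r \<cdot> t = leg2 C X r"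
    "leg2 C X r \<cdot> t = leg1 C X r"
    using r by (auto simp: equivalence_rel_def symmetric_rel_def)
  obtain h where h: "h \<in> Hom C A (Dom C r)" "leg1 C X r \<cdot> h = x" "leg2 C X r \<cdot> h = y"
    using m x by (auto simp: rel_mem_def Hom_Dom)
  have "leg1 C X r \<cdot> (t \<cdot> h) = y" "leg2 C X r \<cdot> (t \<cdot> h) = x"
    using Cmp_assoc[OF h(1) t(1)] R t h by metis+
  thus ?thesis using Cmp_in_Hom[OF h(1) t(1)] 
      Hom_Dom[OF rel_mem_hom[OF equivalence_relD[OF r] m x]] by (auto simp: rel_mem_def)
qed

lemma rel_mem_trans:
  assumes r: "equivalence_rel C X r" and x: "x \<in> Hom C A X"
    and xy: "rel_mem C X r x y" and yz: "rel_mem C X r y z"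
  shows "rel_mem C X r x z"
proof -
  note R = is_relationD[OF equivalence_relD[OF r]]
  \<comment> \<open>\<open>transitive_rel\<close> speaks of every pullback of composable pairs; one
    has to be exhibited before it yields the arrow \<open>t\<close>.\<close>
  obtain P p1 p2 where P: "is_pullback C (leg2 C X r) (leg1 C X r) p1 p2"
    "p1 \<in> Hom C P (Dom C r)" "p2 \<in> Hom C P (Dom C r)" "leg2 C X r \<cdot> p1 = leg1 C X r \<cdot> p2"
    "\<forall>A. \<forall>a\<in>Hom C A (Dom C r). \<forall>b\<in>Hom C A (Dom C r). leg2 C X r \<cdot> a = leg1 C X r \<cdot> b \<longrightarrow>
       (\<exists>h\<in>Hom C A P. p1 \<cdot> h = a \<and> p2 \<cdot> h = b)"
    using pullback_exists[OF R(5,4)] by (elim exE conjE)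
  obtain t where t: "t \<in> Hom C P (Dom C r)" "leg1 C X r \<cdot> t = leg1 C X r \<cdot> p1"
    "leg2 C X r \<cdot> t = leg2 C X r \<cdot> p2"
    using r P(1) Hom_Dom[OF P(2)] unfolding equivalence_rel_def transitive_rel_def by metis
  have y: "y \<in> Hom C A X" using rel_mem_hom[OF equivalence_relD[OF r] xy x] .
  obtain a where a: "a \<in> Hom C A (Dom C r)" "leg1 C X r \<cdot> a = x" "leg2 C X r \<cdot> a = y"
    using xy x by (auto simp: rel_mem_def Hom_Dom)
  obtain b where b: "b \<in> Hom C A (Dom C r)" "leg1 C X r \<cdot> b = y" "leg2 C X r \<cdot> b = z"
    using yz y by (auto simp: rel_mem_def Hom_Dom)
  obtain h where h: "h \<in> Hom C A P" "p1 \<cdot> h = a" "p2 \<cdot> h = b" using P(5) a b by metis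
  have "leg1 C X r \<cdot> (t \<cdot> h) = x"
    using Cmp_assoc[OF h(1) t(1) R(4)] Cmp_assoc[OF h(1) P(2) R(4)] t(2) h(2) a(2) by simp
  moreover have "leg2 C X r \<cdot> (t \<cdot> h) = z"
    using Cmp_assoc[OF h(1) t(1) R(5)] Cmp_assoc[OF h(1) P(3) R(5)] t(3) h(3) b(3) by simp
  ultimately show ?thesis using Cmp_in_Hom[OF h(1) t(1)] Hom_Dom[OF x] by (auto simp: rel_mem_def)
qed

end

section \<open>Locality of membership and relations generated by spans\<close>

context regular_category
begin

text \<open>A factorization of the restricted pair through the monomorphism \<open>r\<close>
  descends along the regular epimorphism \<open>e\<close> by orthogonality.\<close>

lemma rel_mem_local:
  assumes r: "is_relation C X r" and e: "regular_epi C e" "e \<in> Hom C B A"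
    and x: "x \<in> Hom C A X" and y: "y \<in> Hom C A X" and m: "rel_mem C X r (x \<cdot> e) (y \<cdot> e)"
  shows "rel_mem C X r x y"
proof -
  note R = is_relationD[OF r]
  obtain p where p: "p \<in> Hom C A (sq_obj C X)" "pr1 C X \<cdot> p = x" "pr2 C X \<cdot> p = y"
    using sq_pairing[OF x y] by blast
  have "pr1 C X \<cdot> (p \<cdot> e) = x \<cdot> e" "pr2 C X \<cdot> (p \<cdot> e) = y \<cdot> e"
    using Cmp_assoc[OF e(2) p(1)] pr_hom[OF R(1)] p(2,3) by metis+
  then obtain h where "h \<in> Hom C B (Dom C r)" "r \<cdot> h = p \<cdot> e"
    using rel_mem_pairing[OF r Cmp_in_Hom[OF e(2) x] Cmp_in_Hom[OF e(2) p(1)]] m by blast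
  then obtain k where "k \<in> Hom C A (Dom C r)" "r \<cdot> k = p"
    using regular_epi_mono_diagonal[OF e R(2,3) p(1)] by blast
  thus ?thesis using rel_mem_pairing[OF r x p] by blast
qed

text \<open>\<open>r\<close> is the image of the pairing of \<open>x\<close> and \<open>y\<close>.
  An element of an image comes from the source only after a lift along the regular epimorphism onto
  the image, whence the cover \<open>e\<close> in the description.\<close>

lemma span_relation_exists:
  assumes x: "x \<in> Hom C A X" and y: "y \<in> Hom C A X"
  shows "\<exists>r. is_relation C X r \<and>
    (\<forall>B. \<forall>u\<in>Hom C B X. \<forall>v\<in>Hom C B X. rel_mem C X r u v \<longleftrightarrow>
      (\<exists>D e z. regular_epi C e \<and> e \<in> Hom C D B \<and> z \<in> Hom C D A \<and> x \<cdot> z = u \<cdot> e \<and> y \<cdot> z = v \<cdot> e))"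
proof -
  have X: "X \<in> Ob C" using x Hom_Ob by blast
  obtain p where p: "p \<in> Hom C A (sq_obj C X)" "pr1 C X \<cdot> p = x" "pr2 C X \<cdot> p = y"
    using sq_pairing[OF x y] by blast
  obtain I q r where i: "regular_epi C q" "q \<in> Hom C A I" "mono_arrow C r"
    "r \<in> Hom C I (sq_obj C X)" "r \<cdot> q = p" using regular_image[OF p(1)] .
  have r: "is_relation C X r" using X i(3,4) by (simp add: is_relation_def Hom_def)
  have pz: "pr1 C X \<cdot> (r \<cdot> (q \<cdot> z)) = x \<cdot> z \<and> pr2 C X \<cdot> (r \<cdot> (q \<cdot> z)) = y \<cdot> z"
    if z: "z \<in> Hom C D A" for D z
    using Cmp_assoc[OF z i(2,4)] i(5) Cmp_assoc[OF z p(1)] pr_hom[OF X] p(2,3) by metis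
  have "rel_mem C X r u v \<longleftrightarrow>
      (\<exists>D e z. regular_epi C e \<and> e \<in> Hom C D B \<and> z \<in> Hom C D A \<and> x \<cdot> z = u \<cdot> e \<and> y \<cdot> z = v \<cdot> e)"
    if u: "u \<in> Hom C B X" and v: "v \<in> Hom C B X" for B u v
  proof
    assume "rel_mem C X r u v"
    then obtain h where h: "h \<in> Hom C B I" "pr1 C X \<cdot> (r \<cdot> h) = u" "pr2 C X \<cdot> (r \<cdot> h) = v"
      using rel_mem_iff[OF r u] Hom_Dom[OF i(4)] by auto
    obtain D e z where e: "regular_epi C e" "e \<in> Hom C D B" "z \<in> Hom C D A" "q \<cdot> z = h \<cdot> e"
      using regular_epi_lift[OF i(1,2) h(1)] .
    have rh: "r \<cdot> h \<in> Hom C B (sq_obj C X)" using Cmp_in_Hom h(1) i(4) by blast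
    have "r \<cdot> (q \<cdot> z) = (r \<cdot> h) \<cdot> e" using Cmp_assoc[OF e(2) h(1) i(4)] e(4) by simp
    hence "x \<cdot> z = u \<cdot> e" "y \<cdot> z = v \<cdot> e"
      using pz[OF e(3)] Cmp_assoc[OF e(2) rh] pr_hom[OF X] h(2,3) by metis+
    thus "\<exists>D e z. regular_epi C e \<and> e \<in> Hom C D B \<and> z \<in> Hom C D A \<and> x \<cdot> z = u \<cdot> e \<and> y \<cdot> z = v \<cdot> e"
      using e by blast
  next
    assume "\<exists>D e z. regular_epi C e \<and> e \<in> Hom C D B \<and> z \<in> Hom C D A \<and> x \<cdot> z = u \<cdot> e \<and> y \<cdot> z = v \<cdot> e"
    then obtain D e z where e: "regular_epi C e" "e \<in> Hom C D B" "z \<in> Hom C D A"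
      "x \<cdot> z = u \<cdot> e" "y \<cdot> z = v \<cdot> e" by blast
    have "rel_mem C X r (u \<cdot> e) (v \<cdot> e)"
      unfolding rel_mem_iff[OF r Cmp_in_Hom[OF e(2) u]]
      using Cmp_in_Hom[OF e(3) i(2)] Hom_Dom[OF i(4)] pz[OF e(3)] e(4,5) by metis
    thus "rel_mem C X r u v" using rel_mem_local[OF r e(1,2) u v] by blast
  qed
  thus ?thesis using r by blast
qed

end

section \<open>Composites and intersections of equivalence relations\<close>

context exact_maltsev_category
begin

text \<open>Here the Mal'tsev axiom enters: reflexivity, tested on the identity of \<open>X\<close>,
  already gives symmetry and transitivity.\<close>

lemma equivalence_relI:
  "\<lbrakk>is_relation C X r; rel_mem C X r (Idn C X) (Idn C X)\<rbrakk> \<Longrightarrow> equivalence_rel C X r"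
  using reflexive_imp_equivalence reflexive_rel_iff is_relationD(1) by blast

text \<open>\<open>t\<close> is generated by the span of outer legs on the pullback
  \<open>P\<close>, whose elements are the chains of an \<open>r\<close>-step followed by an
  \<open>s\<close>-step. It is reflexive because \<open>r\<close> and \<open>s\<close> are, which
  suffices in a Mal'tsev category.\<close>

lemma composite_equivalence_exists:
  assumes r: "equivalence_rel C X r" and s: "equivalence_rel C X s"
  shows "\<exists>t. equivalence_rel C X t \<and>
    (\<forall>A. \<forall>u\<in>Hom C A X. \<forall>v\<in>Hom C A X. rel_mem C X t u v \<longleftrightarrow>
      (\<exists>B e z. regular_epi C e \<and> e \<in> Hom C B A \<and> rel_mem C X r (u \<cdot> e) z \<and> rel_mem C X s z (v \<cdot> e)))"
proof -
  note R = is_relationD[OF equivalence_relD[OF r]] and S = is_relationD[OF equivalence_relD[OF s]]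
  let ?ex = "\<lambda>A u v. \<exists>B e z. regular_epi C e \<and> e \<in> Hom C B A \<and> rel_mem C X r (u \<cdot> e) z \<and> rel_mem C X s z (v \<cdot> e)"
  obtain P p1 p2 where P: 
    "p1 \<in> Hom C P (Dom C r)" "p2 \<in> Hom C P (Dom C s)" "leg2 C X r \<cdot> p1 = leg1 C X s \<cdot> p2"
    "\<forall>A. \<forall>a\<in>Hom C A (Dom C r). \<forall>b\<in>Hom C A (Dom C s). leg2 C X r \<cdot> a = leg1 C X s \<cdot> b \<longrightarrow>
       (\<exists>h\<in>Hom C A P. p1 \<cdot> h = a \<and> p2 \<cdot> h = b)"
    using pullback_exists[OF R(5) S(4)] by (elim exE conjE)
  obtain t where t: "is_relation C X t"
    "\<forall>B. \<forall>u\<in>Hom C B X. \<forall>v\<in>Hom C B X. rel_mem C X t u v \<longleftrightarrow>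
      (\<exists>D e z. regular_epi C e \<and> e \<in> Hom C D B \<and> z \<in> Hom C D P \<and>
        (leg1 C X r \<cdot> p1) \<cdot> z = u \<cdot> e \<and> (leg2 C X s \<cdot> p2) \<cdot> z = v \<cdot> e)"
    using span_relation_exists[OF Cmp_in_Hom[OF P(1) R(4)] Cmp_in_Hom[OF P(2) S(5)]]
    by (elim exE conjE)
  have mem: "rel_mem C X t u v \<longleftrightarrow> ?ex A u v"
    if u: "u \<in> Hom C A X" and v: "v \<in> Hom C A X" for A u v
  proof
    assume "rel_mem C X t u v"
    then obtain D e z where e: "regular_epi C e" "e \<in> Hom C D A" "z \<in> Hom C D P"
        "(leg1 C X r \<cdot> p1) \<cdot> z = u \<cdot> e" "(leg2 C X s \<cdot> p2) \<cdot> z = v \<cdot> e"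
      using t(2) u v by blast
    have a: "p1 \<cdot> z \<in> Hom C D (Dom C r)" and b: "p2 \<cdot> z \<in> Hom C D (Dom C s)"
      using Cmp_in_Hom e(3) P by blast+
    let ?w = "leg2 C X r \<cdot> (p1 \<cdot> z)"
    have "rel_mem C X r (u \<cdot> e) ?w"
      using Cmp_assoc[OF e(3) P(1) R(4)] e(4) a Hom_Dom[OF Cmp_in_Hom[OF e(2) u]]
      unfolding rel_mem_def by auto
    moreover have w: "?w = leg1 C X s \<cdot> (p2 \<cdot> z)"
      using Cmp_assoc[OF e(3) P(1) R(5)] Cmp_assoc[OF e(3) P(2) S(4)] P(3) by simp
    have "rel_mem C X s ?w (v \<cdot> e)"
      using Cmp_assoc[OF e(3) P(2) S(5)] e(5) b Hom_Dom[OF Cmp_in_Hom[OF a R(5)]] w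
      unfolding rel_mem_def by auto
    ultimately show "?ex A u v" using e(1,2) by blast
  next
    assume "?ex A u v"
    then obtain D e w where e: "regular_epi C e" "e \<in> Hom C D A" 
      and rw: "rel_mem C X r (u \<cdot> e) w" and sw: "rel_mem C X s w (v \<cdot> e)" by blast
    have ue: "u \<cdot> e \<in> Hom C D X" using Cmp_in_Hom[OF e(2) u] .
    have w: "w \<in> Hom C D X" using rel_mem_hom[OF equivalence_relD[OF r] rw ue] .
    obtain a where a: "a \<in> Hom C D (Dom C r)" "leg1 C X r \<cdot> a = u \<cdot> e" "leg2 C X r \<cdot> a = w"
      using rw ue by (auto simp: rel_mem_def Hom_Dom)
    obtain b where b: "b \<in> Hom C D (Dom C s)" "leg1 C X s \<cdot> b = w" "leg2 C X s \<cdot> b = v \<cdot> e"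
      using sw w by (auto simp: rel_mem_def Hom_Dom)
    obtain z where z: "z \<in> Hom C D P" "p1 \<cdot> z = a" "p2 \<cdot> z = b" using P(4) a b by metis
    have "(leg1 C X r \<cdot> p1) \<cdot> z = u \<cdot> e" "(leg2 C X s \<cdot> p2) \<cdot> z = v \<cdot> e"
      using Cmp_assoc[OF z(1) P(1) R(4)] Cmp_assoc[OF z(1) P(2) S(5)] z a b by simp_all
    thus "rel_mem C X t u v" using t(2) u v e z(1) by blast
  qed
  have I: "Idn C X \<in> Hom C X X" using Idn_in_Hom R(1) by blast
  \<comment> \<open>The cover and the middle element are both the identity of
    \<open>X\<close>.\<close>
  have "?ex X (Idn C X) (Idn C X)"
    using rel_mem_refl[OF r I] rel_mem_refl[OF s I] Idn_right[OF I] I regular_epi_Idn[OF R(1)]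
    by metis
  hence "equivalence_rel C X t" using equivalence_relI[OF t(1)] mem[OF I I] by blast
  thus ?thesis using mem by blast
qed

text \<open>\<open>t\<close> is the diagonal of the pullback of the monomorphisms \<open>r\<close>
  and \<open>s\<close>; it is again monic, and an arrow factors through it iff it factors through
  both.\<close>

lemma intersection_equivalence_exists:
  assumes r: "equivalence_rel C X r" and s: "equivalence_rel C X s"
  shows "\<exists>t. equivalence_rel C X t \<and> (\<forall>A. \<forall>u\<in>Hom C A X. \<forall>v\<in>Hom C A X.
    rel_mem C X t u v \<longleftrightarrow> rel_mem C X r u v \<and> rel_mem C X s u v)"
proof -
  note r' = equivalence_relD[OF r] and s' = equivalence_relD[OF s]
  note R = is_relationD[OF r'] and S = is_relationD[OF s']
  obtain p1 p2 where pb: "is_pullback C r s p1 p2" using pullback_exists[OF R(3) S(3)] by blast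
  obtain P where P: "p1 \<in> Hom C P (Dom C r)" "p2 \<in> Hom C P (Dom C s)" "r \<cdot> p1 = s \<cdot> p2"
    "\<forall>A. \<forall>a\<in>Hom C A (Dom C r). \<forall>b\<in>Hom C A (Dom C s). r \<cdot> a = s \<cdot> b \<longrightarrow>
       (\<exists>!h. h \<in> Hom C A P \<and> p1 \<cdot> h = a \<and> p2 \<cdot> h = b)"
    using is_pullbackD[OF pb R(3) S(3)] by (elim exE conjE)
  define t where "t = r \<cdot> p1"
  have t: "t \<in> Hom C P (sq_obj C X)" using Cmp_in_Hom[OF P(1) R(3)] by (simp add: t_def)
  have th: "t \<cdot> h = r \<cdot> (p1 \<cdot> h)" "t \<cdot> h = s \<cdot> (p2 \<cdot> h)" if "h \<in> Hom C A P" for A h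
    using Cmp_assoc[OF that P(1) R(3)] Cmp_assoc[OF that P(2) S(3)] P(3) by (simp_all add: t_def)
  have "mono_arrow C t"
  proof (rule mono_arrowI[OF t])
    fix A f g assume fg: "f \<in> Hom C A P" "g \<in> Hom C A P" "t \<cdot> f = t \<cdot> g"
    have h: "p1 \<cdot> f \<in> Hom C A (Dom C r)" "p2 \<cdot> f \<in> Hom C A (Dom C s)"
      "p1 \<cdot> g \<in> Hom C A (Dom C r)" "p2 \<cdot> g \<in> Hom C A (Dom C s)"
      using Cmp_in_Hom fg P by blast+
    have "p1 \<cdot> f = p1 \<cdot> g"
      using mono_arrowD[OF R(2,3) h(1,3)] th(1)[OF fg(1)] th(1)[OF fg(2)] fg(3) by simp
    moreover have "p2 \<cdot> f = p2 \<cdot> g"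
      using mono_arrowD[OF S(2,3) h(2,4)] th(2)[OF fg(1)] th(2)[OF fg(2)] fg(3) by simp
    moreover have "r \<cdot> (p1 \<cdot> f) = s \<cdot> (p2 \<cdot> f)" using th[OF fg(1)] by simp
    hence "\<exists>!k. k \<in> Hom C A P \<and> p1 \<cdot> k = p1 \<cdot> f \<and> p2 \<cdot> k = p2 \<cdot> f" using P(4) h(1,2) by blast
    ultimately show "f = g" using fg(1,2) by auto
  qed
  hence tr: "is_relation C X t" using R(1) t by (simp add: is_relation_def Hom_def)
  have mem: "rel_mem C X t u v \<longleftrightarrow> rel_mem C X r u v \<and> rel_mem C X s u v"
    if u: "u \<in> Hom C A X" and v: "v \<in> Hom C A X" for A u v
  proof -
    obtain p where p: "p \<in> Hom C A (sq_obj C X)" "pr1 C X \<cdot> p = u" "pr2 C X \<cdot> p = v"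
      using sq_pairing[OF u v] by blast
    have "(\<exists>h\<in>Hom C A P. t \<cdot> h = p) \<longleftrightarrow>
      (\<exists>a\<in>Hom C A (Dom C r). r \<cdot> a = p) \<and> (\<exists>b\<in>Hom C A (Dom C s). s \<cdot> b = p)"
    proof (intro iffI)
      assume "\<exists>h\<in>Hom C A P. t \<cdot> h = p"
      then obtain h where h: "h \<in> Hom C A P" "t \<cdot> h = p" by blast
      show "(\<exists>a\<in>Hom C A (Dom C r). r \<cdot> a = p) \<and> (\<exists>b\<in>Hom C A (Dom C s). s \<cdot> b = p)"
        using th[OF h(1)] h(2) Cmp_in_Hom[OF h(1) P(1)] Cmp_in_Hom[OF h(1) P(2)] by metis
    next
      assume "(\<exists>a\<in>Hom C A (Dom C r). r \<cdot> a = p) \<and> (\<exists>b\<in>Hom C A (Dom C s). s \<cdot> b = p)"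
      then obtain a b where ab: "a \<in> Hom C A (Dom C r)" "r \<cdot> a = p" "b \<in> Hom C A (Dom C s)" "s \<cdot> b = p"
        by blast
      hence "\<exists>!h. h \<in> Hom C A P \<and> p1 \<cdot> h = a \<and> p2 \<cdot> h = b" using P(4) by simp
      then obtain h where "h \<in> Hom C A P" "p1 \<cdot> h = a" by blast
      thus "\<exists>h\<in>Hom C A P. t \<cdot> h = p" using th(1) ab(2) by metis
    qed
    thus ?thesis
      using rel_mem_pairing[OF tr u p] rel_mem_pairing[OF r' u p] rel_mem_pairing[OF s' u p]
        Hom_Dom[OF t] by simp
  qed
  have I: "Idn C X \<in> Hom C X X" using Idn_in_Hom R(1) by blast
  have "equivalence_rel C X t"
    using equivalence_relI[OF tr] mem[OF I I] rel_mem_refl[OF r I] rel_mem_refl[OF s I] by blast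
  thus ?thesis using mem by blast
qed

section \<open>The lattice of equivalence relations and its operations on elements\<close>

lemma Equiv_simps:
  "carrier (Equiv C X) = {r. equivalence_rel C X r}"
  "le (Equiv C X) r s \<longleftrightarrow> sub_le C r s"
  "eq (Equiv C X) r s \<longleftrightarrow> sub_le C r s \<and> sub_le C s r"
  by (simp_all add: Equiv_def)

lemma sub_le_iff:
  assumes "equivalence_rel C X r" "equivalence_rel C X s"
  shows "sub_le C r s \<longleftrightarrow>
    (\<forall>A. \<forall>x\<in>Hom C A X. \<forall>y\<in>Hom C A X. rel_mem C X r x y \<longrightarrow> rel_mem C X s x y)"
  using sub_le_iff_rel_mem equivalence_relD assms by blast

lemma sub_le_trans:
  assumes "sub_le C r s" "sub_le C s t"
    "equivalence_rel C X r" "equivalence_rel C X s" "equivalence_rel C X t"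
  shows "sub_le C r t"
  using assms sub_le_iff[of X] by blast

lemma weak_partial_order_Equiv: "weak_partial_order (Equiv C X)"
  by unfold_locales
    (use sub_le_trans sub_le_iff[of X] in \<open>unfold Equiv_simps mem_Collect_eq, blast+\<close>)

text \<open>Reflexivity puts both relations below their composite, with trivial cover and an
  endpoint as middle element. An upper bound \<open>k\<close> contains every chain by transitivity,
  and locality then removes the cover.\<close>

lemma composite_is_lub:
  assumes r: "equivalence_rel C X r" and s: "equivalence_rel C X s" and t: "equivalence_rel C X t"
    and mem: "\<forall>A. \<forall>u\<in>Hom C A X. \<forall>v\<in>Hom C A X. rel_mem C X t u v \<longleftrightarrow>
      (\<exists>B e z. regular_epi C e \<and> e \<in> Hom C B A \<and> rel_mem C X r (u \<cdot> e) z \<and> rel_mem C X s z (v \<cdot> e))"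
  shows "sub_le C r t" "sub_le C s t"
    "\<lbrakk>equivalence_rel C X k; sub_le C r k; sub_le C s k\<rbrakk> \<Longrightarrow> sub_le C t k"
proof -
  have "rel_mem C X t x y" if x: "x \<in> Hom C A X" and y: "y \<in> Hom C A X"
    and m: "rel_mem C X r x y \<or> rel_mem C X s x y" for A x y
  proof -
    have A: "A \<in> Ob C" using x Hom_Ob by blast
    show "rel_mem C X t x y"
      using mem x y m rel_mem_refl[OF s y] rel_mem_refl[OF r x] Idn_right[OF x] Idn_right[OF y]
        regular_epi_Idn[OF A] Idn_in_Hom[OF A] by metis
  qed
  thus "sub_le C r t" "sub_le C s t" using sub_le_iff[OF _ t] r s by blast+
next
  assume k: "equivalence_rel C X k" and rk: "sub_le C r k" and sk: "sub_le C s k"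
  show "sub_le C t k"
    unfolding sub_le_iff[OF t k]
  proof (intro allI ballI impI)
    fix A x y assume x: "x \<in> Hom C A X" and y: "y \<in> Hom C A X" and m: "rel_mem C X t x y"
    then obtain B e z where e: "regular_epi C e" "e \<in> Hom C B A"
      "rel_mem C X r (x \<cdot> e) z" "rel_mem C X s z (y \<cdot> e)" using mem by blast
    have xe: "x \<cdot> e \<in> Hom C B X" and ye: "y \<cdot> e \<in> Hom C B X" using Cmp_in_Hom e x y by blast+
    have z: "z \<in> Hom C B X" using rel_mem_hom[OF equivalence_relD[OF r] e(3) xe] .
    have "rel_mem C X k (x \<cdot> e) z" using e(3) rk xe z sub_le_iff[OF r k] by blast
    moreover have "rel_mem C X k z (y \<cdot> e)" using e(4) sk ye z sub_le_iff[OF s k] by blast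
    ultimately have "rel_mem C X k (x \<cdot> e) (y \<cdot> e)" using rel_mem_trans[OF k xe] by blast
    thus "rel_mem C X k x y" using rel_mem_local[OF equivalence_relD[OF k] e(1,2) x y] by blast
  qed
qed

lemma weak_lattice_Equiv: "weak_lattice (Equiv C X)"
proof -
  interpret weak_partial_order "Equiv C X" by (rule weak_partial_order_Equiv)
  show ?thesis
  proof unfold_locales
    fix r s assume "r \<in> carrier (Equiv C X)" "s \<in> carrier (Equiv C X)"
    hence r: "equivalence_rel C X r" and s: "equivalence_rel C X s" by (simp_all add: Equiv_simps)
    obtain t where t: "equivalence_rel C X t"
      "\<forall>A. \<forall>u\<in>Hom C A X. \<forall>v\<in>Hom C A X. rel_mem C X t u v \<longleftrightarrow>
      (\<exists>B e z. regular_epi C e \<and> e \<in> Hom C B A \<and> rel_mem C X r (u \<cdot> e) z \<and> rel_mem C X s z (v \<cdot> e))"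
      using composite_equivalence_exists[OF r s] by (elim exE conjE)
    have "least (Equiv C X) t (Upper (Equiv C X) {r, s})"
      using composite_is_lub[OF r s t] r s t(1) unfolding least_def Upper_def Equiv_simps by auto
    thus "\<exists>t. least (Equiv C X) t (Upper (Equiv C X) {r, s})" by blast
    obtain u where u: "equivalence_rel C X u" "\<forall>A. \<forall>x\<in>Hom C A X. \<forall>y\<in>Hom C A X.
      rel_mem C X u x y \<longleftrightarrow> rel_mem C X r x y \<and> rel_mem C X s x y"
      using intersection_equivalence_exists[OF r s] by (elim exE conjE)
    have "sub_le C u r" "sub_le C u s" using u sub_le_iff r s by blast+
    moreover have "sub_le C k u" if "equivalence_rel C X k" "sub_le C k r" "sub_le C k s" for k
      using that u sub_le_iff[OF that(1)] r s by blast
    ultimately have "greatest (Equiv C X) u (Lower (Equiv C X) {r, s})"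
      using r s u(1) unfolding greatest_def Lower_def Equiv_simps by auto
    thus "\<exists>u. greatest (Equiv C X) u (Lower (Equiv C X) {r, s})" by blast
  qed
qed

lemma join_Equiv:
  assumes r: "equivalence_rel C X r" and s: "equivalence_rel C X s"
  shows "equivalence_rel C X (r \<squnion>\<^bsub>Equiv C X\<^esub> s)"
    "sub_le C r (r \<squnion>\<^bsub>Equiv C X\<^esub> s)" "sub_le C s (r \<squnion>\<^bsub>Equiv C X\<^esub> s)"
    "\<lbrakk>equivalence_rel C X k; sub_le C r k; sub_le C s k\<rbrakk> \<Longrightarrow> sub_le C (r \<squnion>\<^bsub>Equiv C X\<^esub> s) k"
proof -
  interpret weak_lattice "Equiv C X" by (rule weak_lattice_Equiv)
  show "equivalence_rel C X (r \<squnion>\<^bsub>Equiv C X\<^esub> s)"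
    "sub_le C r (r \<squnion>\<^bsub>Equiv C X\<^esub> s)" "sub_le C s (r \<squnion>\<^bsub>Equiv C X\<^esub> s)"
    "\<lbrakk>equivalence_rel C X k; sub_le C r k; sub_le C s k\<rbrakk> \<Longrightarrow> sub_le C (r \<squnion>\<^bsub>Equiv C X\<^esub> s) k"
    using join_closed[of r s] join_left[of r s] join_right[of r s] join_le[of r k s] r s
    unfolding Equiv_simps mem_Collect_eq by blast+
qed

lemma meet_Equiv:
  assumes r: "equivalence_rel C X r" and s: "equivalence_rel C X s"
  shows "equivalence_rel C X (r \<sqinter>\<^bsub>Equiv C X\<^esub> s)"
    "sub_le C (r \<sqinter>\<^bsub>Equiv C X\<^esub> s) r" "sub_le C (r \<sqinter>\<^bsub>Equiv C X\<^esub> s) s"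
    "\<lbrakk>equivalence_rel C X k; sub_le C k r; sub_le C k s\<rbrakk> \<Longrightarrow> sub_le C k (r \<sqinter>\<^bsub>Equiv C X\<^esub> s)"
proof -
  interpret weak_lattice "Equiv C X" by (rule weak_lattice_Equiv)
  show "equivalence_rel C X (r \<sqinter>\<^bsub>Equiv C X\<^esub> s)"
    "sub_le C (r \<sqinter>\<^bsub>Equiv C X\<^esub> s) r" "sub_le C (r \<sqinter>\<^bsub>Equiv C X\<^esub> s) s"
    "\<lbrakk>equivalence_rel C X k; sub_le C k r; sub_le C k s\<rbrakk> \<Longrightarrow> sub_le C k (r \<sqinter>\<^bsub>Equiv C X\<^esub> s)"
    using meet_closed[of r s] meet_left[of r s] meet_right[of r s] meet_le[of k r s] r s
    unfolding Equiv_simps mem_Collect_eq by blast+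
qed

text \<open>The join in \<open>Equiv C X\<close> is chosen among all least upper bounds, so it need
  not be the composite \<open>t\<close> itself; but the two include each other and hence have the
  same elements.\<close>

lemma rel_mem_join_iff:
  assumes r: "equivalence_rel C X r" and s: "equivalence_rel C X s"
    and u: "u \<in> Hom C A X" and v: "v \<in> Hom C A X"
  shows "rel_mem C X (r \<squnion>\<^bsub>Equiv C X\<^esub> s) u v \<longleftrightarrow>
    (\<exists>B e z. regular_epi C e \<and> e \<in> Hom C B A \<and> rel_mem C X r (u \<cdot> e) z \<and> rel_mem C X s z (v \<cdot> e))"
proof -
  note J = join_Equiv[OF r s]
  obtain t where t: "equivalence_rel C X t"
    "\<forall>A. \<forall>u\<in>Hom C A X. \<forall>v\<in>Hom C A X. rel_mem C X t u v \<longleftrightarrow>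
    (\<exists>B e z. regular_epi C e \<and> e \<in> Hom C B A \<and> rel_mem C X r (u \<cdot> e) z \<and> rel_mem C X s z (v \<cdot> e))"
    using composite_equivalence_exists[OF r s] by (elim exE conjE)
  note lub = composite_is_lub[OF r s t]
  have "sub_le C t (r \<squnion>\<^bsub>Equiv C X\<^esub> s)" "sub_le C (r \<squnion>\<^bsub>Equiv C X\<^esub> s) t"
    using lub(3)[OF J(1-3)] J(4)[OF t(1) lub(1,2)] .
  hence "rel_mem C X (r \<squnion>\<^bsub>Equiv C X\<^esub> s) u v \<longleftrightarrow> rel_mem C X t u v"
    using sub_le_iff[OF J(1) t(1)] sub_le_iff[OF t(1) J(1)] u v by blast
  thus ?thesis using t(2) u v by simp
qed

lemma rel_mem_meet_iff:
  assumes r: "equivalence_rel C X r" and s: "equivalence_rel C X s"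
    and u: "u \<in> Hom C A X" and v: "v \<in> Hom C A X"
  shows "rel_mem C X (r \<sqinter>\<^bsub>Equiv C X\<^esub> s) u v \<longleftrightarrow> rel_mem C X r u v \<and> rel_mem C X s u v"
proof -
  note M = meet_Equiv[OF r s]
  obtain t where t: "equivalence_rel C X t" "\<forall>A. \<forall>x\<in>Hom C A X. \<forall>y\<in>Hom C A X.
    rel_mem C X t x y \<longleftrightarrow> rel_mem C X r x y \<and> rel_mem C X s x y"
    using intersection_equivalence_exists[OF r s] by (elim exE conjE)
  have "sub_le C t r" "sub_le C t s" using t sub_le_iff[OF t(1)] r s by blast+
  hence "sub_le C t (r \<sqinter>\<^bsub>Equiv C X\<^esub> s)" using M(4) t(1) by blast
  thus ?thesis
    using t(2) sub_le_iff[OF t(1) M(1)] sub_le_iff[OF M(1) r] sub_le_iff[OF M(1) s] M(2,3) u v by blast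
qed

end

section \<open>Quotients\<close>

context exact_maltsev_category
begin

text \<open>Effectiveness presents \<open>r\<close> as the kernel pair of some \<open>f\<close>,
  which need not be a regular epimorphism. The coequalizer \<open>q\<close> of the legs has the same
  kernel pair, since \<open>f\<close> factors through \<open>q\<close>.\<close>

lemma quot_exists:
  assumes r: "equivalence_rel C X r"
  shows "\<exists>q. regular_epi C q \<and> is_kernel_pair C q (leg1 C X r) (leg2 C X r)"
proof -
  note R = is_relationD[OF equivalence_relD[OF r]]
  let ?l1 = "leg1 C X r" and ?l2 = "leg2 C X r" and ?P = "Dom C r"
  obtain f where f: "is_kernel_pair C f ?l1 ?l2" using effective[OF r] by blast
  obtain q where q: "is_coequalizer C ?l1 ?l2 q" using kernel_pair_coequalizer[OF f] by blast
  obtain Q where Q: "q \<in> Hom C X Q" "q \<cdot> ?l1 = q \<cdot> ?l2"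
    "\<forall>B. \<forall>f\<in>Hom C X B. f \<cdot> ?l1 = f \<cdot> ?l2 \<longrightarrow> (\<exists>!h. h \<in> Hom C Q B \<and> h \<cdot> q = f)"
    using is_coequalizerD[OF q R(4)] by (elim exE conjE)
  \<comment> \<open>The typing of \<open>f\<close> is hidden in an existential; its source is
    \<open>X\<close> because the legs end there.\<close>
  obtain X' Z P' where "f \<in> Hom C X' Z" "?l1 \<in> Hom C P' X'"
    using f unfolding is_kernel_pair_def is_pullback_def by (elim exE conjE)
  hence fX: "f \<in> Hom C X Z" using R(4) by (simp add: Hom_def)
  obtain P where P: "?l1 \<in> Hom C P X" "f \<cdot> ?l1 = f \<cdot> ?l2"
    "\<forall>A. \<forall>a\<in>Hom C A X. \<forall>b\<in>Hom C A X. f \<cdot> a = f \<cdot> b \<longrightarrow>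
           (\<exists>!h. h \<in> Hom C A P \<and> ?l1 \<cdot> h = a \<and> ?l2 \<cdot> h = b)"
    using is_pullbackD[OF f[unfolded is_kernel_pair_def] fX fX] by (elim exE conjE)
  have P': "P = ?P" using P(1) R(4) by (simp add: Hom_def)
  obtain m where m: "m \<in> Hom C Q Z" "m \<cdot> q = f" using Q(3) fX P(2) by blast
  have "f \<cdot> a = f \<cdot> b" if "a \<in> Hom C A X" "b \<in> Hom C A X" "q \<cdot> a = q \<cdot> b" for A a b
    using Cmp_assoc[OF that(1) Q(1) m(1)] Cmp_assoc[OF that(2) Q(1) m(1)] m(2) that(3) by simp
  hence "\<forall>A. \<forall>a\<in>Hom C A X. \<forall>b\<in>Hom C A X. q \<cdot> a = q \<cdot> b \<longrightarrow>
           (\<exists>!h. h \<in> Hom C A ?P \<and> ?l1 \<cdot> h = a \<and> ?l2 \<cdot> h = b)" using P(3) unfolding P' by blast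
  hence "is_kernel_pair C q ?l1 ?l2"
    unfolding is_kernel_pair_def is_pullback_def
    using Q(1,2) R(4,5) by (intro exI[of _ X] exI[of _ Q] exI[of _ ?P] conjI)
  thus ?thesis using q by (auto simp: regular_epi_def)
qed

text \<open>\<open>quot_eq_iff\<close> is the dictionary between limits and congruences: the legs of
  \<open>r\<close> form the kernel pair of the quotient, so equality after the quotient is
  membership in \<open>r\<close>.\<close>

lemma quot_props:
  assumes r: "equivalence_rel C X r"
  shows quot_regular_epi: "regular_epi C (quot C X r)"
    and quot_hom: "quot C X r \<in> Hom C X (Cod C (quot C X r))"
    and quot_eq_iff: "\<lbrakk>a \<in> Hom C A X; b \<in> Hom C A X\<rbrakk>
      \<Longrightarrow> quot C X r \<cdot> a = quot C X r \<cdot> b \<longleftrightarrow> rel_mem C X r a b"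
proof -
  note R = is_relationD[OF equivalence_relD[OF r]]
  let ?l1 = "leg1 C X r" and ?l2 = "leg2 C X r" and ?q = "quot C X r"
  have q: "regular_epi C ?q \<and> is_kernel_pair C ?q ?l1 ?l2"
    unfolding quot_def by (rule someI_ex[OF quot_exists[OF r]])
  thus "regular_epi C ?q" by blast
  obtain X' Z P' where "?q \<in> Hom C X' Z" "?l1 \<in> Hom C P' X'"
    using q unfolding is_kernel_pair_def is_pullback_def by (elim exE conjE)
  thus h: "?q \<in> Hom C X (Cod C ?q)" using R(4) by (simp add: Hom_def)
  obtain P where P: "?l1 \<in> Hom C P X" "?q \<cdot> ?l1 = ?q \<cdot> ?l2"
    "\<forall>A. \<forall>a\<in>Hom C A X. \<forall>b\<in>Hom C A X. ?q \<cdot> a = ?q \<cdot> b \<longrightarrow>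
           (\<exists>!h. h \<in> Hom C A P \<and> ?l1 \<cdot> h = a \<and> ?l2 \<cdot> h = b)"
    using is_pullbackD[OF conjunct2[OF q, unfolded is_kernel_pair_def] h h] by (elim exE conjE)
  have P': "P = Dom C r" using P(1) R(4) by (simp add: Hom_def)
  assume a: "a \<in> Hom C A X" and b: "b \<in> Hom C A X"
  show "?q \<cdot> a = ?q \<cdot> b \<longleftrightarrow> rel_mem C X r a b"
  proof
    assume "?q \<cdot> a = ?q \<cdot> b"
    thus "rel_mem C X r a b" using P(3) a b unfolding P' rel_mem_def Hom_Dom[OF a] by blast
  next
    assume "rel_mem C X r a b"
    then obtain k where k: "k \<in> Hom C A (Dom C r)" "?l1 \<cdot> k = a" "?l2 \<cdot> k = b"
      by (auto simp: rel_mem_def Hom_Dom[OF a])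
    thus "?q \<cdot> a = ?q \<cdot> b"
      using Cmp_assoc[OF k(1) R(4) h] Cmp_assoc[OF k(1) R(5) h] P(2) by simp
  qed
qed

lemma rel_mem_mono:
  assumes "sub_le C r s" "equivalence_rel C X r" "equivalence_rel C X s"
    "x \<in> Hom C A X" "y \<in> Hom C A X" "rel_mem C X r x y"
  shows "rel_mem C X s x y"
  using sub_le_iff[OF assms(2,3)] assms by blast

text \<open>Some pair \<open>u\<close>, \<open>v\<close> has \<open>quot C X r\<close> as its
  coequalizer. It lies in \<open>r\<close>, hence in \<open>s\<close>, so \<open>quot C X s\<close>
  coequalizes it as well; the factorization exists uniquely, as \<open>THE\<close> requires.\<close>

lemma quot_map_props:
  assumes r: "equivalence_rel C X r" and s: "equivalence_rel C X s" and le: "sub_le C r s"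
  shows quot_map_hom: "quot_map C X r s \<in> Hom C (Cod C (quot C X r)) (Cod C (quot C X s))"
    and quot_map_quot: "quot_map C X r s \<cdot> quot C X r = quot C X s"
proof -
  let ?q = "quot C X r"
  obtain u W v where c: "u \<in> Hom C W X" "v \<in> Hom C W X" "?q \<cdot> u = ?q \<cdot> v"
    "\<forall>B. \<forall>f\<in>Hom C X B. f \<cdot> u = f \<cdot> v \<longrightarrow> (\<exists>!h. h \<in> Hom C (Cod C ?q) B \<and> h \<cdot> ?q = f)"
    using regular_epi_coequalizer[OF quot_regular_epi[OF r] quot_hom[OF r]] by blast
  have "quot C X s \<cdot> u = quot C X s \<cdot> v"
    using quot_eq_iff[OF r c(1,2)] quot_eq_iff[OF s c(1,2)] c(3) rel_mem_mono[OF le r s c(1,2)]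
    by blast
  hence "\<exists>!h. h \<in> Hom C (Cod C ?q) (Cod C (quot C X s)) \<and> h \<cdot> ?q = quot C X s"
    using c(4) quot_hom[OF s] by blast
  from theI'[OF this] show "quot_map C X r s \<in> Hom C (Cod C ?q) (Cod C (quot C X s))"
    "quot_map C X r s \<cdot> ?q = quot C X s" unfolding quot_map_def by blast+
qed

lemma quot_map_quot_elem:
  assumes r: "equivalence_rel C X r" and s: "equivalence_rel C X s" and le: "sub_le C r s"
    and x: "x \<in> Hom C A X"
  shows "quot_map C X r s \<cdot> (quot C X r \<cdot> x) = quot C X s \<cdot> x"
  using Cmp_assoc[OF x quot_hom[OF r] quot_map_hom[OF r s le]] quot_map_quot[OF r s le] by simp


section \<open>The Chinese Remainder condition on generalized elements\<close>

text \<open>Quantifying over generalized elements up to regular epimorphisms is the Kripke--Joyal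
  reading of ``pairwise compatible congruences have a common solution''.\<close>

definition (in -) locally_solvable ::
  "('o, 'm, 'z) cat_scheme \<Rightarrow> 'o \<Rightarrow> nat \<Rightarrow> (nat \<Rightarrow> 'm) \<Rightarrow> bool" where
  "locally_solvable C X n \<theta> \<longleftrightarrow>
     (\<forall>A x. A \<in> Ob C \<longrightarrow> (\<forall>i\<in>{1..n}. x i \<in> Hom C A X) \<longrightarrow>
        (\<forall>i j. 1 \<le> i \<longrightarrow> i < j \<longrightarrow> j \<le> n \<longrightarrow> rel_mem C X (\<theta> i \<squnion>\<^bsub>Equiv C X\<^esub> \<theta> j) (x i) (x j)) \<longrightarrow>
        (\<exists>B e y. regular_epi C e \<and> e \<in> Hom C B A \<and> y \<in> Hom C B X \<and>
           (\<forall>i\<in>{1..n}. rel_mem C X (\<theta> i) y (x i \<cdot>\<^bsub>C\<^esub> e))))"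

section \<open>The Chinese Remainder diagram and its cones\<close>

lemma crt_rel_equivalence:
  assumes \<theta>: "\<forall>i\<in>{1..n}. equivalence_rel C X (\<theta> i)" and v: "v \<in> crt_vertices n"
  shows "equivalence_rel C X (crt_rel C X \<theta> v)"
  using \<theta> v join_Equiv(1) by (auto simp: crt_rel_def crt_vertices_def)

lemma crt_diagram:
  assumes \<theta>: "\<forall>i\<in>{1..n}. equivalence_rel C X (\<theta> i)"
  shows "finite (crt_vertices n)" "finite (crt_edges C X n \<theta>)"
    "is_diagram C (crt_vertices n) (crt_ob C X \<theta>) (crt_edges C X n \<theta>)"
proof -
  have "crt_vertices n \<subseteq> {..n} \<times> {..n}" by (auto simp: crt_vertices_def)
  thus "finite (crt_vertices n)" by (rule finite_subset) simp
  have "crt_edges C X n \<theta> \<subseteq>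
    (\<lambda>(i, j). ((i, i), (i, j), quot_map C X (\<theta> i) (\<theta> i \<squnion>\<^bsub>Equiv C X\<^esub> \<theta> j))) ` ({..n} \<times> {..n}) \<union>
    (\<lambda>(i, j). ((j, j), (i, j), quot_map C X (\<theta> j) (\<theta> i \<squnion>\<^bsub>Equiv C X\<^esub> \<theta> j))) ` ({..n} \<times> {..n})"
    by (auto simp: crt_edges_def)
  thus "finite (crt_edges C X n \<theta>)" by (rule finite_subset) simp
  show "is_diagram C (crt_vertices n) (crt_ob C X \<theta>) (crt_edges C X n \<theta>)"
    unfolding is_diagram_def
  proof (intro conjI ballI)
    fix v assume "v \<in> crt_vertices n"
    thus "crt_ob C X \<theta> v \<in> Ob C"
      using quot_hom[OF crt_rel_equivalence[OF \<theta>]] Hom_Ob unfolding crt_ob_def by blast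
  next
    fix e assume "e \<in> crt_edges C X n \<theta>"
    then obtain i j where ij: "1 \<le> i" "i < j" "j \<le> n" and
      "e = ((i, i), (i, j), quot_map C X (\<theta> i) (\<theta> i \<squnion>\<^bsub>Equiv C X\<^esub> \<theta> j)) \<or>
       e = ((j, j), (i, j), quot_map C X (\<theta> j) (\<theta> i \<squnion>\<^bsub>Equiv C X\<^esub> \<theta> j))"
      by (auto simp: crt_edges_def)
    moreover have "equivalence_rel C X (\<theta> i)" "equivalence_rel C X (\<theta> j)" using \<theta> ij by auto
    ultimately show "case e of (u, v, f) \<Rightarrow> u \<in> crt_vertices n \<and> v \<in> crt_vertices n \<and>
        f \<in> Hom C (crt_ob C X \<theta> u) (crt_ob C X \<theta> v)"
      using quot_map_hom join_Equiv(1-3)[of X "\<theta> i" "\<theta> j"]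
      by (auto simp: crt_vertices_def crt_ob_def crt_rel_def)
  qed
qed

text \<open>The leg at \<open>(i, j)\<close> is defined from \<open>x i\<close>; the edge from
  \<open>(j, j)\<close> commutes because compatibility makes \<open>x i\<close> and
  \<open>x j\<close> equal modulo the join. The constant family at the identity yields the cone of
  quotients.\<close>

lemma crt_cone:
  assumes \<theta>: "\<forall>i\<in>{1..n}. equivalence_rel C X (\<theta> i)"
    and A: "A \<in> Ob C" and x: "\<forall>i\<in>{1..n}. x i \<in> Hom C A X"
    and compat: "\<forall>i j. 1 \<le> i \<longrightarrow> i < j \<longrightarrow> j \<le> n \<longrightarrow>
      rel_mem C X (\<theta> i \<squnion>\<^bsub>Equiv C X\<^esub> \<theta> j) (x i) (x j)"
  shows "is_cone C (crt_vertices n) (crt_ob C X \<theta>) (crt_edges C X n \<theta>) A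
    (\<lambda>v. quot C X (crt_rel C X \<theta> v) \<cdot> x (fst v))"
  unfolding is_cone_def
proof (intro conjI ballI)
  fix v assume v: "v \<in> crt_vertices n"
  hence "x (fst v) \<in> Hom C A X" using x by (auto simp: crt_vertices_def)
  thus "quot C X (crt_rel C X \<theta> v) \<cdot> x (fst v) \<in> Hom C A (crt_ob C X \<theta> v)"
    using quot_hom[OF crt_rel_equivalence[OF \<theta> v]] Cmp_in_Hom unfolding crt_ob_def by blast
next
  fix e assume "e \<in> crt_edges C X n \<theta>"
  then obtain i j where ij: "1 \<le> i" "i < j" "j \<le> n" and
    e: "e = ((i, i), (i, j), quot_map C X (\<theta> i) (\<theta> i \<squnion>\<^bsub>Equiv C X\<^esub> \<theta> j)) \<or>
     e = ((j, j), (i, j), quot_map C X (\<theta> j) (\<theta> i \<squnion>\<^bsub>Equiv C X\<^esub> \<theta> j))"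
    by (auto simp: crt_edges_def)
  have t: "equivalence_rel C X (\<theta> i)" "equivalence_rel C X (\<theta> j)" 
    and xx: "x i \<in> Hom C A X" "x j \<in> Hom C A X" using \<theta> x ij by auto
  note J = join_Equiv[OF t]
  have "quot C X (\<theta> i \<squnion>\<^bsub>Equiv C X\<^esub> \<theta> j) \<cdot> x i = quot C X (\<theta> i \<squnion>\<^bsub>Equiv C X\<^esub> \<theta> j) \<cdot> x j"
    using quot_eq_iff[OF J(1) xx] compat ij by blast
  thus "case e of (u, v, f) \<Rightarrow> f \<cdot> (quot C X (crt_rel C X \<theta> u) \<cdot> x (fst u)) =
    quot C X (crt_rel C X \<theta> v) \<cdot> x (fst v)"
    using e ij(2) quot_map_quot_elem[OF t(1) J(1,2) xx(1)] quot_map_quot_elem[OF t(2) J(1,3) xx(2)]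
    by (auto simp: crt_rel_def)
qed (rule A)

text \<open>Lifts are collected one at a time. Each new lift passes to a finer cover, again a
  regular epimorphism because these compose, and the earlier lifts are restricted to it.\<close>

lemma simultaneous_lift:
  assumes "finite S" "L \<in> Ob C"
    "\<forall>i\<in>S. regular_epi C (f i) \<and> f i \<in> Hom C X (Q i) \<and> p i \<in> Hom C L (Q i)"
  shows "\<exists>B e x. regular_epi C e \<and> e \<in> Hom C B L \<and>
    (\<forall>i\<in>S. x i \<in> Hom C B X \<and> f i \<cdot> x i = p i \<cdot> e)"
  using assms(1,3)
proof (induction S rule: finite_induct)
  case empty
  show ?case using regular_epi_Idn[OF assms(2)] Idn_in_Hom[OF assms(2)] by blast
next
  case (insert k S)
  then obtain B e x where e: "regular_epi C e" "e \<in> Hom C B L"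
    "\<forall>i\<in>S. x i \<in> Hom C B X \<and> f i \<cdot> x i = p i \<cdot> e" by blast
  have f: "regular_epi C (f k)" "f k \<in> Hom C X (Q k)" "p k \<in> Hom C L (Q k)"
    using insert.prems by auto
  obtain D d y where d: "regular_epi C d" "d \<in> Hom C D B" "y \<in> Hom C D X" "f k \<cdot> y = (p k \<cdot> e) \<cdot> d"
    using regular_epi_lift[OF f(1,2) Cmp_in_Hom[OF e(2) f(3)]] .
  let ?x = "\<lambda>i. if i = k then y else x i \<cdot> d"
  have "?x i \<in> Hom C D X \<and> f i \<cdot> ?x i = p i \<cdot> (e \<cdot> d)" if "i \<in> insert k S" for i
  proof (cases "i = k")
    case True
    thus ?thesis using d Cmp_assoc[OF d(2) e(2) f(3)] by simp
  next
    case False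
    hence i: "x i \<in> Hom C B X" "f i \<cdot> x i = p i \<cdot> e" "f i \<in> Hom C X (Q i)" "p i \<in> Hom C L (Q i)"
      using that e(3) insert.prems by auto
    thus ?thesis
      using False Cmp_assoc[OF d(2) i(1,3)] Cmp_assoc[OF d(2) e(2) i(4)] Cmp_in_Hom[OF d(2) i(1)]
      by simp
  qed
  thus ?case using regular_epi_comp[OF d(1,2) e(1,2)] Cmp_in_Hom[OF d(2) e(2)]
    by (intro exI[of _ D] exI[of _ "e \<cdot> d"] exI[of _ ?x]) blast
qed

text \<open>A compatible family induces an arrow \<open>l\<close> into the limit; lifting
  \<open>l\<close> locally along the regular epimorphism \<open>c\<close> yields the
  solution.\<close>

lemma satisfies_CRT_imp_locally_solvable:
  assumes \<theta>: "\<forall>i\<in>{1..n}. equivalence_rel C X (\<theta> i)" and X: "X \<in> Ob C"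
    and crt: "satisfies_CRT C X n \<theta>"
  shows "locally_solvable C X n \<theta>"
  unfolding locally_solvable_def
proof (intro allI impI)
  let ?V = "crt_vertices n" and ?D = "crt_ob C X \<theta>" and ?E = "crt_edges C X n \<theta>"
  \<comment> \<open>\<open>satisfies_CRT\<close> quantifies over all limit cones, so an actual one
    is needed to apply it.\<close>
  obtain L p where L: "is_limit C ?V ?D ?E L p" using limit_exists[OF crt_diagram[OF \<theta>]] by blast
  have I: "Idn C X \<in> Hom C X X" using Idn_in_Hom X .
  have "rel_mem C X (\<theta> i \<squnion>\<^bsub>Equiv C X\<^esub> \<theta> j) (Idn C X) (Idn C X)" if "1 \<le> i" "i < j" "j \<le> n" for i j
    using rel_mem_refl[OF join_Equiv(1) I] \<theta> that by simp
  hence "is_cone C ?V ?D ?E X (\<lambda>v. quot C X (crt_rel C X \<theta> v) \<cdot> Idn C X)"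
    using crt_cone[OF \<theta> X, of "\<lambda>_. Idn C X"] I by simp
  then obtain c where c: "c \<in> Hom C X L" "\<forall>v\<in>?V. p v \<cdot> c = quot C X (crt_rel C X \<theta> v) \<cdot> Idn C X"
    using L unfolding is_limit_def by blast
  have c': "\<forall>v\<in>?V. p v \<cdot> c = quot C X (crt_rel C X \<theta> v)"
    using c(2) Idn_right[OF quot_hom[OF crt_rel_equivalence[OF \<theta>]]] by simp
  hence rc: "regular_epi C c" using crt L c(1) unfolding satisfies_CRT_def by blast
  fix A x
  assume A: "A \<in> Ob C" and x: "\<forall>i\<in>{1..n}. x i \<in> Hom C A X"
    and "\<forall>i j. 1 \<le> i \<longrightarrow> i < j \<longrightarrow> j \<le> n \<longrightarrow> rel_mem C X (\<theta> i \<squnion>\<^bsub>Equiv C X\<^esub> \<theta> j) (x i) (x j)"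
  hence "is_cone C ?V ?D ?E A (\<lambda>v. quot C X (crt_rel C X \<theta> v) \<cdot> x (fst v))"
    using crt_cone[OF \<theta> A x] by blast
  then obtain l where l: "l \<in> Hom C A L" "\<forall>v\<in>?V. p v \<cdot> l = quot C X (crt_rel C X \<theta> v) \<cdot> x (fst v)"
    using L unfolding is_limit_def by blast
  obtain B e y where e: "regular_epi C e" "e \<in> Hom C B A" "y \<in> Hom C B X" "c \<cdot> y = l \<cdot> e"
    using regular_epi_lift[OF rc c(1) l(1)] .
  have "rel_mem C X (\<theta> i) y (x i \<cdot> e)" if i: "i \<in> {1..n}" for i
  proof -
    have v: "(i, i) \<in> ?V" and cr: "crt_rel C X \<theta> (i, i) = \<theta> i" and t: "equivalence_rel C X (\<theta> i)"
      and xi: "x i \<in> Hom C A X"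
      using i \<theta> x by (auto simp: crt_vertices_def crt_rel_def)
    have p: "p (i, i) \<in> Hom C L (Cod C (quot C X (\<theta> i)))"
      using L v cr unfolding is_limit_def is_cone_def crt_ob_def by metis
    \<comment> \<open>Comparing components at the vertex \<open>(i, i)\<close> shows that
      \<open>y\<close> agrees with the restriction of \<open>x i\<close> modulo
      \<open>\<theta> i\<close>.\<close>
    have "quot C X (\<theta> i) \<cdot> y = p (i, i) \<cdot> (c \<cdot> y)"
      using Cmp_assoc[OF e(3) c(1) p] c' v cr by simp
    also have "\<dots> = (quot C X (\<theta> i) \<cdot> x i) \<cdot> e"
      using Cmp_assoc[OF e(2) l(1) p] e(4) l(2) v cr by simp
    also have "\<dots> = quot C X (\<theta> i) \<cdot> (x i \<cdot> e)" using Cmp_assoc[OF e(2) xi quot_hom[OF t]] .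
    finally show ?thesis using quot_eq_iff[OF t e(3) Cmp_in_Hom[OF e(2) xi]] by blast
  qed
  thus "\<exists>B e y. regular_epi C e \<and> e \<in> Hom C B A \<and> y \<in> Hom C B X \<and>
           (\<forall>i\<in>{1..n}. rel_mem C X (\<theta> i) y (x i \<cdot> e))" using e by blast
qed

text \<open>The identity of \<open>L\<close> acts as a generic compatible family: the projections
  \<open>p (i, i)\<close> are lifted to \<open>x i\<close> on a cover \<open>e\<close>, and a
  solution \<open>y\<close> on a further cover \<open>d\<close> satisfies
  \<open>c \<cdot> y = e \<cdot> d\<close>. Thus \<open>c \<cdot> y\<close> is a regular
  epimorphism, and so is \<open>c\<close>.\<close>

lemma locally_solvable_imp_satisfies_CRT:
  assumes \<theta>: "\<forall>i\<in>{1..n}. equivalence_rel C X (\<theta> i)"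
    and solv: "locally_solvable C X n \<theta>"
  shows "satisfies_CRT C X n \<theta>"
  unfolding satisfies_CRT_def
proof (intro allI impI, elim conjE)
  let ?V = "crt_vertices n" and ?D = "crt_ob C X \<theta>" and ?E = "crt_edges C X n \<theta>"
  fix L p c
  assume L: "is_limit C ?V ?D ?E L p" and c: "c \<in> Hom C X L"
    and pc: "\<forall>v\<in>?V. p v \<cdot> c = quot C X (crt_rel C X \<theta> v)"
  have cone: "is_cone C ?V ?D ?E L p" using L by (simp add: is_limit_def)
  have LO: "L \<in> Ob C" using cone by (simp add: is_cone_def)
  have pv: "p v \<in> Hom C L (?D v)" if "v \<in> ?V" for v using cone that by (simp add: is_cone_def)
  have diag: "(i, i) \<in> ?V" "crt_rel C X \<theta> (i, i) = \<theta> i" "equivalence_rel C X (\<theta> i)"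
    "p (i, i) \<in> Hom C L (Cod C (quot C X (\<theta> i)))" if "i \<in> {1..n}" for i
    using that \<theta> pv[of "(i, i)"] by (auto simp: crt_vertices_def crt_rel_def crt_ob_def)
  let ?J = "\<lambda>i j. \<theta> i \<squnion>\<^bsub>Equiv C X\<^esub> \<theta> j"
  have edge: "quot_map C X (\<theta> i) (?J i j) \<cdot> p (i, i) = p (i, j)"
     "quot_map C X (\<theta> j) (?J i j) \<cdot> p (j, j) = p (i, j)" if "1 \<le> i" "i < j" "j \<le> n" for i j
  proof -
    have "((i, i), (i, j), quot_map C X (\<theta> i) (?J i j)) \<in> ?E"
      "((j, j), (i, j), quot_map C X (\<theta> j) (?J i j)) \<in> ?E" using that by (auto simp: crt_edges_def)
    thus "quot_map C X (\<theta> i) (?J i j) \<cdot> p (i, i) = p (i, j)"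
     "quot_map C X (\<theta> j) (?J i j) \<cdot> p (j, j) = p (i, j)"
      using cone unfolding is_cone_def by blast+
  qed
  \<comment> \<open>Lifts of the components \<open>i\<close> and \<open>j\<close> of an element
    \<open>h\<close> of \<open>L\<close> both become \<open>p (i, j) \<cdot> h\<close> modulo the
    join. With different lifts this gives compatibility; with one common lift it gives agreement at
    the vertex \<open>(i, j)\<close>.\<close>
  have off_diag: "quot C X (?J i j) \<cdot> z = p (i, j) \<cdot> h" "quot C X (?J i j) \<cdot> w = p (i, j) \<cdot> h"
    if ij: "1 \<le> i" "i < j" "j \<le> n" and z: "z \<in> Hom C A X" and w: "w \<in> Hom C A X" and h: "h \<in> Hom C A L"
      and zi: "quot C X (\<theta> i) \<cdot> z = p (i, i) \<cdot> h" and wj: "quot C X (\<theta> j) \<cdot> w = p (j, j) \<cdot> h"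
    for A i j z w h
  proof -
    have i: "i \<in> {1..n}" and j: "j \<in> {1..n}" using ij by auto
    note J = join_Equiv[OF diag(3)[OF i] diag(3)[OF j]]
    have "quot C X (?J i j) \<cdot> z = quot_map C X (\<theta> i) (?J i j) \<cdot> (p (i, i) \<cdot> h)"
      using quot_map_quot_elem[OF diag(3)[OF i] J(1,2) z] zi by simp
    thus "quot C X (?J i j) \<cdot> z = p (i, j) \<cdot> h"
      using Cmp_assoc[OF h diag(4)[OF i] quot_map_hom[OF diag(3)[OF i] J(1,2)]] edge(1)[OF ij] by simp
    have "quot C X (?J i j) \<cdot> w = quot_map C X (\<theta> j) (?J i j) \<cdot> (p (j, j) \<cdot> h)"
      using quot_map_quot_elem[OF diag(3)[OF j] J(1,3) w] wj by simp
    thus "quot C X (?J i j) \<cdot> w = p (i, j) \<cdot> h"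
      using Cmp_assoc[OF h diag(4)[OF j] quot_map_hom[OF diag(3)[OF j] J(1,3)]] edge(2)[OF ij] by simp
  qed
  have "\<forall>i\<in>{1..n}. regular_epi C (quot C X (\<theta> i)) \<and> quot C X (\<theta> i) \<in> Hom C X (Cod C (quot C X (\<theta> i)))
      \<and> p (i, i) \<in> Hom C L (Cod C (quot C X (\<theta> i)))"
    using quot_regular_epi quot_hom diag by blast
  then obtain B e x where e: "regular_epi C e" "e \<in> Hom C B L"
    and x: "\<forall>i\<in>{1..n}. x i \<in> Hom C B X \<and> quot C X (\<theta> i) \<cdot> x i = p (i, i) \<cdot> e"
    using simultaneous_lift[of "{1..n}" L "\<lambda>i. quot C X (\<theta> i)" X "\<lambda>i. Cod C (quot C X (\<theta> i))"
        "\<lambda>i. p (i, i)"] LO by auto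
  have compat: "rel_mem C X (?J i j) (x i) (x j)" if ij: "1 \<le> i" "i < j" "j \<le> n" for i j
  proof -
    have i: "i \<in> {1..n}" and j: "j \<in> {1..n}" using ij by auto
    have xx: "x i \<in> Hom C B X" "x j \<in> Hom C B X" using x i j by auto
    show ?thesis
      using off_diag[OF ij xx e(2)] x i j quot_eq_iff[OF join_Equiv(1)[OF diag(3)[OF i] diag(3)[OF j]] xx]
      by simp
  qed
  have "B \<in> Ob C" using e(2) Hom_Ob by blast
  then obtain D d y where d: "regular_epi C d" "d \<in> Hom C D B" "y \<in> Hom C D X"
    "\<forall>i\<in>{1..n}. rel_mem C X (\<theta> i) y (x i \<cdot> d)"
    using solv x compat unfolding locally_solvable_def by blast
  have ed: "e \<cdot> d \<in> Hom C D L" and cy: "c \<cdot> y \<in> Hom C D L" using Cmp_in_Hom d e c by blast+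
  have sol: "quot C X (\<theta> i) \<cdot> y = p (i, i) \<cdot> (e \<cdot> d)" if i: "i \<in> {1..n}" for i
  proof -
    have xi: "x i \<in> Hom C B X" using x i by blast
    have "quot C X (\<theta> i) \<cdot> y = quot C X (\<theta> i) \<cdot> (x i \<cdot> d)"
      using quot_eq_iff[OF diag(3)[OF i] d(3) Cmp_in_Hom[OF d(2) xi]] d(4) i by blast
    also have "\<dots> = (p (i, i) \<cdot> e) \<cdot> d"
      using Cmp_assoc[OF d(2) xi quot_hom[OF diag(3)[OF i]]] x i by simp
    also have "\<dots> = p (i, i) \<cdot> (e \<cdot> d)" using Cmp_assoc[OF d(2) e(2) diag(4)[OF i]] .
    finally show ?thesis .
  qed
  have agree: "p v \<cdot> (c \<cdot> y) = p v \<cdot> (e \<cdot> d)" if v: "v \<in> ?V" for v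
  proof -
    obtain i j where ij: "v = (i, j)" "1 \<le> i" "i \<le> j" "j \<le> n"
      using v by (auto simp: crt_vertices_def)
    have i: "i \<in> {1..n}" and j: "j \<in> {1..n}" using ij by auto
    have "p v \<cdot> (c \<cdot> y) = quot C X (crt_rel C X \<theta> v) \<cdot> y"
      using Cmp_assoc[OF d(3) c pv[OF v]] pc v by simp
    also have "\<dots> = p v \<cdot> (e \<cdot> d)"
    proof (cases "i = j")
      case True
      thus ?thesis using sol[OF i] ij(1) by (simp add: crt_rel_def)
    next
      case False
      thus ?thesis using off_diag(1)[of i j y D y "e \<cdot> d"] ij d(3) ed sol[OF i] sol[OF j]
        by (simp add: crt_rel_def)
    qed
    finally show ?thesis .
  qed
  \<comment> \<open>Both \<open>c \<cdot> y\<close> and \<open>e \<cdot> d\<close> factor this cone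
    through \<open>L\<close>, so uniqueness identifies them.\<close>
  have "is_cone C ?V ?D ?E D (\<lambda>v. p v \<cdot> (e \<cdot> d))"
    unfolding is_cone_def
  proof (intro conjI ballI)
    show "D \<in> Ob C" using d(2) Hom_Ob by blast
    show "p v \<cdot> (e \<cdot> d) \<in> Hom C D (?D v)" if "v \<in> ?V" for v using Cmp_in_Hom[OF ed pv[OF that]] .
    fix a assume a: "a \<in> ?E"
    obtain u v f where a': "a = (u, v, f)" by (cases a)
    have "u \<in> ?V" "f \<in> Hom C (?D u) (?D v)"
      using crt_diagram(3)[OF \<theta>] a unfolding is_diagram_def a' by blast+
    moreover have "f \<cdot> p u = p v" using cone a unfolding is_cone_def a' by blast
    ultimately show "case a of (u, v, f) \<Rightarrow> f \<cdot> (p u \<cdot> (e \<cdot> d)) = p v \<cdot> (e \<cdot> d)"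
      using Cmp_assoc[OF ed pv, of u f "?D v"] by (simp add: a')
  qed
  hence "\<exists>!h. h \<in> Hom C D L \<and> (\<forall>v\<in>?V. p v \<cdot> h = p v \<cdot> (e \<cdot> d))"
    using L unfolding is_limit_def by blast
  hence "c \<cdot> y = e \<cdot> d" using ed cy agree by blast
  thus "regular_epi C c"
    using regular_epi_of_factor[OF c d(3)] regular_epi_comp[OF d(1,2) e(1,2)] by simp
qed

lemma CRT_iff_locally_solvable:
  "CRT C n \<longleftrightarrow> (\<forall>X\<in>Ob C. \<forall>\<theta>. (\<forall>i\<in>{1..n}. equivalence_rel C X (\<theta> i)) \<longrightarrow> locally_solvable C X n \<theta>)"
  unfolding CRT_def Equiv_simps mem_Collect_eq
  using satisfies_CRT_imp_locally_solvable locally_solvable_imp_satisfies_CRT by blast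


section \<open>Distributivity\<close>

text \<open>The meet on the left turns into two premises on elements. Only this inclusion appears,
  because the reverse one holds in every lattice.\<close>

lemma distributive_Equiv_iff:
  "distributive_weak_lattice (Equiv C X) \<longleftrightarrow>
    (\<forall>r s t A. \<forall>x\<in>Hom C A X. \<forall>y\<in>Hom C A X.
      equivalence_rel C X r \<longrightarrow> equivalence_rel C X s \<longrightarrow> equivalence_rel C X t \<longrightarrow>
      rel_mem C X r x y \<longrightarrow> rel_mem C X (s \<squnion>\<^bsub>Equiv C X\<^esub> t) x y \<longrightarrow>
      rel_mem C X ((r \<sqinter>\<^bsub>Equiv C X\<^esub> s) \<squnion>\<^bsub>Equiv C X\<^esub> (r \<sqinter>\<^bsub>Equiv C X\<^esub> t)) x y)" (is "?L \<longleftrightarrow> ?R")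
proof -
  let ?l = "\<lambda>r s t. r \<sqinter>\<^bsub>Equiv C X\<^esub> (s \<squnion>\<^bsub>Equiv C X\<^esub> t)"
    and ?r = "\<lambda>r s t. (r \<sqinter>\<^bsub>Equiv C X\<^esub> s) \<squnion>\<^bsub>Equiv C X\<^esub> (r \<sqinter>\<^bsub>Equiv C X\<^esub> t)"
  have key: "(eq (Equiv C X) (?l r s t) (?r r s t)) \<longleftrightarrow>
    (\<forall>A. \<forall>x\<in>Hom C A X. \<forall>y\<in>Hom C A X. rel_mem C X r x y \<longrightarrow> rel_mem C X (s \<squnion>\<^bsub>Equiv C X\<^esub> t) x y \<longrightarrow>
      rel_mem C X (?r r s t) x y)"
    if r: "equivalence_rel C X r" and s: "equivalence_rel C X s" and t: "equivalence_rel C X t"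
    for r s t
  proof -
    note J = join_Equiv[OF s t] and M1 = meet_Equiv[OF r s] and M2 = meet_Equiv[OF r t]
    note M = meet_Equiv[OF r J(1)] and K = join_Equiv[OF M1(1) M2(1)]
    have "sub_le C (r \<sqinter>\<^bsub>Equiv C X\<^esub> s) (?l r s t)" "sub_le C (r \<sqinter>\<^bsub>Equiv C X\<^esub> t) (?l r s t)"
      using M(4)[OF M1(1,2) sub_le_trans[OF M1(3) J(2) M1(1) s J(1)]]
        M(4)[OF M2(1,2) sub_le_trans[OF M2(3) J(3) M2(1) t J(1)]] .
    hence "sub_le C (?r r s t) (?l r s t)" using K(4) M(1) by blast
    thus ?thesis
      using sub_le_iff[OF M(1) K(1)] rel_mem_meet_iff[OF r J(1)] by (auto simp: Equiv_simps)
  qed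
  show ?thesis
    unfolding distributive_weak_lattice_def Equiv_simps(1) using weak_lattice_Equiv key by auto
qed

lemma CRT3_imp_distributive:
  assumes "CRT C 3" "X \<in> Ob C"
  shows "distributive_weak_lattice (Equiv C X)"
  unfolding distributive_Equiv_iff
proof (intro allI ballI impI)
  fix r s t A x y
  assume x: "x \<in> Hom C A X" and y: "y \<in> Hom C A X" and r: "equivalence_rel C X r"
    and s: "equivalence_rel C X s" and t: "equivalence_rel C X t" 
    and rxy: "rel_mem C X r x y" and st: "rel_mem C X (s \<squnion>\<^bsub>Equiv C X\<^esub> t) x y"
  \<comment> \<open>Indices 1, 2, 3 carry \<open>r\<close>, \<open>s\<close>, \<open>t\<close> and
    the elements \<open>x\<close>, \<open>x\<close>, \<open>y\<close>. Repeating \<open>x\<close>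
    makes the solution related to \<open>x\<close> by both \<open>r\<close> and
    \<open>s\<close>.\<close>
  define \<theta> where "\<theta> = (\<lambda>i::nat. if i = 1 then r else if i = 2 then s else t)"
  define f where "f = (\<lambda>i::nat. if i = 3 then y else x)"
  have "locally_solvable C X 3 \<theta>"
    using assms r s t unfolding CRT_iff_locally_solvable by (simp add: \<theta>_def)
  moreover have "rel_mem C X (\<theta> i \<squnion>\<^bsub>Equiv C X\<^esub> \<theta> j) (f i) (f j)" if ij: "1 \<le> i" "i < j" "j \<le> 3" for i j
  proof -
    \<comment> \<open>The three pairs are compatible by reflexivity, by the premise on
      \<open>r\<close> and by the premise on the join of \<open>s\<close> and \<open>t\<close>, in
      this order.\<close>
    consider "i = 1" "j = 2" | "i = 1" "j = 3" | "i = 2" "j = 3" using ij by linarith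
    thus ?thesis
    proof cases
      case 1
      thus ?thesis using rel_mem_refl[OF join_Equiv(1)[OF r s] x] by (simp add: \<theta>_def f_def)
    next
      case 2
      note J = join_Equiv[OF r t]
      show ?thesis using rel_mem_mono[OF J(2) r J(1) x y rxy] 2 by (simp add: \<theta>_def f_def)
    next
      case 3
      thus ?thesis using st by (simp add: \<theta>_def f_def)
    qed
  qed
  moreover have "A \<in> Ob C" using x Hom_Ob by blast
  moreover have "\<forall>i\<in>{1..3}. f i \<in> Hom C A X" using x y by (simp add: f_def)
  ultimately obtain B e z where e: "regular_epi C e" "e \<in> Hom C B A" "z \<in> Hom C B X"
    and z: "\<forall>i\<in>{1..3}. rel_mem C X (\<theta> i) z (f i \<cdot> e)"
    unfolding locally_solvable_def by blast
  have xe: "x \<cdot> e \<in> Hom C B X" and ye: "y \<cdot> e \<in> Hom C B X" using Cmp_in_Hom e x y by blast+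
  have zz: "rel_mem C X r z (x \<cdot> e)" "rel_mem C X s z (x \<cdot> e)" "rel_mem C X t z (y \<cdot> e)"
    using z[rule_format, of 1] z[rule_format, of 2] z[rule_format, of 3] by (simp_all add: \<theta>_def f_def)
  \<comment> \<open>The remaining link, \<open>r\<close> between \<open>z\<close> and
    \<open>y\<close>, goes through \<open>x\<close>.\<close>
  have "rel_mem C X r z (y \<cdot> e)"
    using rel_mem_trans[OF r e(3) zz(1)] rel_mem_comp[OF equivalence_relD[OF r] rxy x e(2)] by blast
  hence "rel_mem C X (r \<sqinter>\<^bsub>Equiv C X\<^esub> t) z (y \<cdot> e)" using rel_mem_meet_iff[OF r t e(3) ye] zz(3) by blast
  moreover have "rel_mem C X (r \<sqinter>\<^bsub>Equiv C X\<^esub> s) (x \<cdot> e) z"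
    using rel_mem_meet_iff[OF r s xe e(3)] rel_mem_sym[OF r e(3) zz(1)] rel_mem_sym[OF s e(3) zz(2)]
    by blast
  ultimately show "rel_mem C X ((r \<sqinter>\<^bsub>Equiv C X\<^esub> s) \<squnion>\<^bsub>Equiv C X\<^esub> (r \<sqinter>\<^bsub>Equiv C X\<^esub> t)) x y"
    using rel_mem_join_iff[OF meet_Equiv(1)[OF r s] meet_Equiv(1)[OF r t] x y] e(1,2) by blast
qed

text \<open>Distributing \<open>r \<squnion> t\<close> over \<open>s \<squnion> t\<close> leaves two
  pieces. The piece with \<open>t\<close> lies below \<open>t\<close>; the piece with
  \<open>s\<close> is distributed again, into \<open>s \<sqinter> r\<close> and
  \<open>s \<sqinter> t\<close>, both below the required join.\<close>

lemma distributive_imp_dual_distributive: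
  assumes dist: "distributive_weak_lattice (Equiv C X)"
    and r: "equivalence_rel C X r" and s: "equivalence_rel C X s" and t: "equivalence_rel C X t"
    and x: "x \<in> Hom C A X" and y: "y \<in> Hom C A X"
    and rt: "rel_mem C X (r \<squnion>\<^bsub>Equiv C X\<^esub> t) x y" and st: "rel_mem C X (s \<squnion>\<^bsub>Equiv C X\<^esub> t) x y"
  shows "rel_mem C X ((r \<sqinter>\<^bsub>Equiv C X\<^esub> s) \<squnion>\<^bsub>Equiv C X\<^esub> t) x y"
proof -
  note D = dist[unfolded distributive_Equiv_iff, rule_format]
  let ?a = "r \<squnion>\<^bsub>Equiv C X\<^esub> t" and ?T = "(r \<sqinter>\<^bsub>Equiv C X\<^esub> s) \<squnion>\<^bsub>Equiv C X\<^esub> t"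
  note a = join_Equiv(1)[OF r t] and T = join_Equiv[OF meet_Equiv(1)[OF r s] t]
  have le: "sub_le C (k \<sqinter>\<^bsub>Equiv C X\<^esub> t) ?T" if "equivalence_rel C X k" for k
    unfolding sub_le_iff[OF meet_Equiv(1)[OF that t] T(1)]
    using rel_mem_meet_iff[OF that t] rel_mem_mono[OF T(3) t T(1)] by blast
  \<comment> \<open>The meet depends only on the set of its two arguments, so swapping them gives
    the same arrow and not just an equal subobject.\<close>
  have "sub_le C (s \<sqinter>\<^bsub>Equiv C X\<^esub> r) ?T"
    using T(2) by (simp add: meet_comm[of "Equiv C X" s r])
  hence K: "sub_le C ((s \<sqinter>\<^bsub>Equiv C X\<^esub> r) \<squnion>\<^bsub>Equiv C X\<^esub> (s \<sqinter>\<^bsub>Equiv C X\<^esub> t)) ?T"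
    using join_Equiv(4)[OF meet_Equiv(1)[OF s r] meet_Equiv(1)[OF s t] T(1)] le[OF s] by blast
  have "sub_le C (?a \<sqinter>\<^bsub>Equiv C X\<^esub> s) ?T"
    unfolding sub_le_iff[OF meet_Equiv(1)[OF a s] T(1)]
  proof (intro allI ballI impI)
    fix B u v assume uv: "u \<in> Hom C B X" "v \<in> Hom C B X" and "rel_mem C X (?a \<sqinter>\<^bsub>Equiv C X\<^esub> s) u v"
    hence "rel_mem C X ?a u v" "rel_mem C X s u v" using rel_mem_meet_iff[OF a s uv] by blast+
    from D[OF uv s r t this(2,1)] show "rel_mem C X ?T u v"
      using rel_mem_mono[OF K join_Equiv(1)[OF meet_Equiv(1)[OF s r] meet_Equiv(1)[OF s t]] T(1) uv]
      by blast
  qed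
  hence "sub_le C ((?a \<sqinter>\<^bsub>Equiv C X\<^esub> s) \<squnion>\<^bsub>Equiv C X\<^esub> (?a \<sqinter>\<^bsub>Equiv C X\<^esub> t)) ?T"
    using join_Equiv(4)[OF meet_Equiv(1)[OF a s] meet_Equiv(1)[OF a t] T(1)] le[OF a] by blast
  from rel_mem_mono[OF this join_Equiv(1)[OF meet_Equiv(1)[OF a s] meet_Equiv(1)[OF a t]] T(1) x y
      D[OF x y a s t rt st]]
  show ?thesis .
qed

lemma (in -) ball_atLeastAtMost_Suc:
  fixes P :: "nat \<Rightarrow> bool"
  shows "(\<forall>i\<in>{1..Suc m}. P i) \<longleftrightarrow> (\<forall>i\<in>{1..m}. P i) \<and> P (Suc m)"
proof -
  have "{1..Suc m} = insert (Suc m) {1..m}" by auto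
  thus ?thesis by auto
qed

text \<open>\<open>r\<close> is the iterated meet, described through its elements; dual
  distributivity against an arbitrary further \<open>t\<close> is carried along in the induction.
  Counting up to \<open>Suc k\<close> starts it at \<open>\<theta> 1\<close> in place of an empty
  meet.\<close>

lemma finite_meet_dual_distributive:
  assumes dist: "distributive_weak_lattice (Equiv C X)"
    and "\<forall>i\<in>{1..Suc k}. equivalence_rel C X (\<theta> i)"
  shows "\<exists>r. equivalence_rel C X r \<and>
    (\<forall>A. \<forall>x\<in>Hom C A X. \<forall>y\<in>Hom C A X.
       rel_mem C X r x y \<longleftrightarrow> (\<forall>i\<in>{1..Suc k}. rel_mem C X (\<theta> i) x y)) \<and>
    (\<forall>t A. \<forall>x\<in>Hom C A X. \<forall>y\<in>Hom C A X. equivalence_rel C X t \<longrightarrow>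
       (\<forall>i\<in>{1..Suc k}. rel_mem C X (\<theta> i \<squnion>\<^bsub>Equiv C X\<^esub> t) x y) \<longrightarrow> rel_mem C X (r \<squnion>\<^bsub>Equiv C X\<^esub> t) x y)"
  using assms(2)
proof (induction k)
  case 0
  thus ?case by (intro exI[of _ "\<theta> 1"]) simp
next
  case (Suc k)
  then obtain r where r: "equivalence_rel C X r"
    "\<forall>A. \<forall>x\<in>Hom C A X. \<forall>y\<in>Hom C A X.
       rel_mem C X r x y \<longleftrightarrow> (\<forall>i\<in>{1..Suc k}. rel_mem C X (\<theta> i) x y)"
    "\<forall>t A. \<forall>x\<in>Hom C A X. \<forall>y\<in>Hom C A X. equivalence_rel C X t \<longrightarrow>
       (\<forall>i\<in>{1..Suc k}. rel_mem C X (\<theta> i \<squnion>\<^bsub>Equiv C X\<^esub> t) x y) \<longrightarrow> rel_mem C X (r \<squnion>\<^bsub>Equiv C X\<^esub> t) x y"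
    by auto
  have s: "equivalence_rel C X (\<theta> (Suc (Suc k)))" using Suc.prems by simp
  show ?case
    unfolding ball_atLeastAtMost_Suc[of "Suc k"]
    using meet_Equiv(1)[OF r(1) s] rel_mem_meet_iff[OF r(1) s] r(2,3)
      distributive_imp_dual_distributive[OF dist r(1) s]
    by (intro exI[of _ "r \<sqinter>\<^bsub>Equiv C X\<^esub> \<theta> (Suc (Suc k))"]) blast
qed

text \<open>Induction on the number of relations: a solution for the first ones is corrected within
  their meet \<open>r\<close> so that it also solves the last congruence. A single congruence is
  solved by its own element.\<close>

lemma distributive_imp_locally_solvable:
  assumes dist: "distributive_weak_lattice (Equiv C X)"
    and "\<forall>i\<in>{1..Suc k}. equivalence_rel C X (\<theta> i)"
  shows "locally_solvable C X (Suc k) \<theta>"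
  using assms(2)
proof (induction k)
  case 0
  show ?case
    unfolding locally_solvable_def
  proof (intro allI impI)
    fix A x assume A: "A \<in> Ob C" and "\<forall>i\<in>{1..Suc 0}. x i \<in> Hom C A X"
    hence x: "x 1 \<in> Hom C A X" by simp
    have "\<forall>i\<in>{1..Suc 0}. rel_mem C X (\<theta> i) (x 1) (x i \<cdot> Idn C A)"
      using rel_mem_refl[OF _ x] 0 Idn_right[OF x] by simp
    thus "\<exists>B e y. regular_epi C e \<and> e \<in> Hom C B A \<and> y \<in> Hom C B X \<and>
           (\<forall>i\<in>{1..Suc 0}. rel_mem C X (\<theta> i) y (x i \<cdot> e))"
      using regular_epi_Idn[OF A] Idn_in_Hom[OF A] x by blast
  qed
next
  case (Suc k)
  let ?n = "Suc (Suc k)"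
  have \<theta>: "\<forall>i\<in>{1..Suc k}. equivalence_rel C X (\<theta> i)" and s: "equivalence_rel C X (\<theta> ?n)"
    using Suc.prems by simp_all
  obtain r where r: "equivalence_rel C X r"
    "\<forall>A. \<forall>x\<in>Hom C A X. \<forall>y\<in>Hom C A X.
       rel_mem C X r x y \<longleftrightarrow> (\<forall>i\<in>{1..Suc k}. rel_mem C X (\<theta> i) x y)"
    "\<forall>t A. \<forall>x\<in>Hom C A X. \<forall>y\<in>Hom C A X. equivalence_rel C X t \<longrightarrow>
       (\<forall>i\<in>{1..Suc k}. rel_mem C X (\<theta> i \<squnion>\<^bsub>Equiv C X\<^esub> t) x y) \<longrightarrow> rel_mem C X (r \<squnion>\<^bsub>Equiv C X\<^esub> t) x y"
    using finite_meet_dual_distributive[OF dist \<theta>] by (elim exE conjE)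
  have solv: "locally_solvable C X (Suc k) \<theta>" using Suc.IH \<theta> by blast
  show ?case
    unfolding locally_solvable_def
  proof (intro allI impI)
    fix A x assume A: "A \<in> Ob C" and x: "\<forall>i\<in>{1..?n}. x i \<in> Hom C A X"
      and compat: "\<forall>i j. 1 \<le> i \<longrightarrow> i < j \<longrightarrow> j \<le> ?n \<longrightarrow>
        rel_mem C X (\<theta> i \<squnion>\<^bsub>Equiv C X\<^esub> \<theta> j) (x i) (x j)"
    have x': "\<forall>i\<in>{1..Suc k}. x i \<in> Hom C A X" and xn: "x ?n \<in> Hom C A X" using x by auto
    have "\<forall>i j. 1 \<le> i \<longrightarrow> i < j \<longrightarrow> j \<le> Suc k \<longrightarrow>
        rel_mem C X (\<theta> i \<squnion>\<^bsub>Equiv C X\<^esub> \<theta> j) (x i) (x j)" using compat by simp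
    then obtain B e y where e: "regular_epi C e" "e \<in> Hom C B A" "y \<in> Hom C B X"
      and y: "\<forall>i\<in>{1..Suc k}. rel_mem C X (\<theta> i) y (x i \<cdot> e)"
      using solv[unfolded locally_solvable_def, rule_format, OF A, of x] x' by blast
    have xne: "x ?n \<cdot> e \<in> Hom C B X" using Cmp_in_Hom[OF e(2) xn] .
    \<comment> \<open>Through \<open>x i\<close>, the old solution is tied to the new target modulo
      each join with the last relation.\<close>
    have "rel_mem C X (\<theta> i \<squnion>\<^bsub>Equiv C X\<^esub> \<theta> ?n) y (x ?n \<cdot> e)" if i: "i \<in> {1..Suc k}" for i
    proof -
      have t: "equivalence_rel C X (\<theta> i)" and xi: "x i \<in> Hom C A X" using \<theta> x' i by auto
      note J = join_Equiv[OF t s]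
      have "rel_mem C X (\<theta> i \<squnion>\<^bsub>Equiv C X\<^esub> \<theta> ?n) y (x i \<cdot> e)"
        using rel_mem_mono[OF J(2) t J(1) e(3) Cmp_in_Hom[OF e(2) xi]] y i by blast
      moreover have "rel_mem C X (\<theta> i \<squnion>\<^bsub>Equiv C X\<^esub> \<theta> ?n) (x i) (x ?n)"
        using compat i by simp
      hence "rel_mem C X (\<theta> i \<squnion>\<^bsub>Equiv C X\<^esub> \<theta> ?n) (x i \<cdot> e) (x ?n \<cdot> e)"
        using rel_mem_comp[OF equivalence_relD[OF J(1)] _ xi e(2)] by blast
      ultimately show ?thesis using rel_mem_trans[OF J(1) e(3)] by blast
    qed
    \<comment> \<open>Dual distributivity gathers these joins into one; its middle element
      \<open>z\<close> is the corrected solution.\<close>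
    hence "rel_mem C X (r \<squnion>\<^bsub>Equiv C X\<^esub> \<theta> ?n) y (x ?n \<cdot> e)" using r(3) e(3) xne s by blast
    then obtain D d z where d: "regular_epi C d" "d \<in> Hom C D B"
      "rel_mem C X r (y \<cdot> d) z" "rel_mem C X (\<theta> ?n) z ((x ?n \<cdot> e) \<cdot> d)"
      using rel_mem_join_iff[OF r(1) s e(3) xne] by blast
    have yd: "y \<cdot> d \<in> Hom C D X" using Cmp_in_Hom[OF d(2) e(3)] .
    have z: "z \<in> Hom C D X" using rel_mem_hom[OF equivalence_relD[OF r(1)] d(3) yd] .
    \<comment> \<open>Moving along \<open>r\<close> preserves the earlier congruences, since
      \<open>r\<close> lies in each of the first \<open>Suc k\<close> relations.\<close>
    have "rel_mem C X (\<theta> i) z (x i \<cdot> (e \<cdot> d))" if i: "i \<in> {1..Suc k}" for i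
    proof -
      have t: "equivalence_rel C X (\<theta> i)" and xi: "x i \<in> Hom C A X" using \<theta> x' i by auto
      have "rel_mem C X (\<theta> i) (y \<cdot> d) z" using r(2) d(3) yd z i by blast
      hence zy: "rel_mem C X (\<theta> i) z (y \<cdot> d)" using rel_mem_sym[OF t yd] by blast
      have "rel_mem C X (\<theta> i) (y \<cdot> d) ((x i \<cdot> e) \<cdot> d)"
        using rel_mem_comp[OF equivalence_relD[OF t] _ e(3) d(2)] y i by blast
      thus ?thesis using rel_mem_trans[OF t z zy] Cmp_assoc[OF d(2) e(2) xi] by simp
    qed
    moreover have "rel_mem C X (\<theta> ?n) z (x ?n \<cdot> (e \<cdot> d))"
      using d(4) Cmp_assoc[OF d(2) e(2) xn] by simp
    ultimately have "\<forall>i\<in>{1..?n}. rel_mem C X (\<theta> i) z (x i \<cdot> (e \<cdot> d))"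
      unfolding ball_atLeastAtMost_Suc[of "Suc k"] by blast
    thus "\<exists>B e y. regular_epi C e \<and> e \<in> Hom C B A \<and> y \<in> Hom C B X \<and>
           (\<forall>i\<in>{1..?n}. rel_mem C X (\<theta> i) y (x i \<cdot> e))"
      using regular_epi_comp[OF d(1,2) e(1,2)] Cmp_in_Hom[OF d(2) e(2)] z by blast
  qed
qed

end

theorem theorem5p3:
  fixes C :: "('o, 'm) cat"
  assumes "exact_maltsev_category C"
  shows "(arithmetical C \<longleftrightarrow> CRT C 3) \<and>
         (CRT C 3 \<longleftrightarrow> (\<forall>n\<ge>2. CRT C n))"
proof -
  interpret exact_maltsev_category C by fact
  have "arithmetical C" if "CRT C 3"
    using CRT3_imp_distributive[OF that] assms by (simp add: arithmetical_def)
  moreover have "CRT C n" if arith: "arithmetical C" and n: "n \<ge> 2" for n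
  proof -
    obtain k where "n = Suc k" using n by (cases n) auto
    thus ?thesis
      using distributive_imp_locally_solvable arith
      unfolding CRT_iff_locally_solvable arithmetical_def by blast
  qed
  \<comment> \<open>The way back from all \<open>n\<close> to \<open>CRT C 3\<close> is the instance
    \<open>n = 3\<close>.\<close>
  ultimately show ?thesis by (metis numeral_le_iff semiring_norm(68,72,73))
qed

end
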